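(* Let $(X_1,X_2,X_3,X_4)$ be a mean zero Gaussian vector with $4\times 4$ positive definite covariance matrix $\Sigma$, and let $\sigma_{ij}$ and $v_1=(v_{11},v_{21})$ be the quantities associated with $\Sigma^{-1}$ as described in the context. Then the following two conditions are equivalent, and if they are satisfied, the vector $(X_1^2+X_2^2,\,X_3^2+X_4^2)$ is infinitely divisible: (i) There exists a $(2,2)$-signature matrix $U$ such that $U^t\Sigma^{-1}U$ has non-positive off-diagonal elements. (ii) The inequality $v_{21}\sigma_{24}(v_{21}\sigma_{24}+v_{11}\sigma_{14})\ge 0$ holds.
   Context: A $(2,2)$-signature matrix is a $4\times 4$ matrix of the form $\begin{pmatrix} U_1 & 0 \\ 0 & U_2 \end{pmatrix}$ with $U_1,U_2$ orthogonal $2\times2$ matrices. A random vector is infinitely divisible if for every $n\in\mathbb{N}$ it has the same distribution as a sum of $n$ i.i.d. random vectors. Convention: for a symmetric $2\times 2$ matrix, "the eigenvector associated with the largest eigenvalue" is a (nonzero) eigenvector for its largest eigenvalue; if the matrix is a multiple of the identity, this eigenvector is fixed to be $(1,0)$. Setting: write $\Sigma^{-1}=\begin{pmatrix} \Sigma^{11} & \Sigma^{12} \\ \Sigma^{21} & \Sigma^{22} \end{pmatrix}$ with $2\times2$ blocks. Let $W=\begin{pmatrix} W_1 & 0 \\ 0 & W_2 \end{pmatrix}$ be a $(2,2)$-signature matrix such that $$W^t\Sigma^{-1}W=\begin{pmatrix} W_1^t\Sigma^{11}W_1 & W_1^t\Sigma^{12}W_2 \\ W_2^t\Sigma^{21}W_1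 & W_2^t\Sigma^{22}W_2 \end{pmatrix}=\begin{pmatrix} \sigma_{11} & 0 & \sigma_{13} & \sigma_{14} \\ 0 & \sigma_{22} & \sigma_{23} & \sigma_{24} \\ \sigma_{13} & \sigma_{23} & \sigma_{33} & 0 \\ \sigma_{14} & \sigma_{24} & 0 & \sigma_{44} \end{pmatrix},\qquad \sigma_{11}\ge\sigma_{22}>0,\;\sigma_{33}\ge\sigma_{44}>0$$ (such $W$ exists). Thus $\sigma_{ij}$ is the $(i,j)$ entry of $W^t\Sigma^{-1}W$, not of $\Sigma^{-1}$. Let $v_1=(v_{11},v_{21})$ be the eigenvector of $W_1^t\Sigma^{12}\Sigma^{21}W_1$ associated with the largest eigenvalue. If $\sigma_{11}=\sigma_{22}$ (so that any orthogonal $W_1$ gives the desired form) or $\sigma_{33}=\sigma_{44}$ (so that any orthogonal $W_2$ gives the desired form), one may choose $W_1$ or $W_2$ such that $v_{21}\sigma_{24}(v_{21}\sigma_{24}+v_{11}\sigma_{14})\ge0$, and in that case $W$ is fixed to be such a choice. *)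

theory Defs
  imports "HOL-Probability.Probability"
begin

section \<open>Matrices\<close>

definition positive_definite :: "real ^ 'n ^ 'n \<Rightarrow> bool" where
  "positive_definite A \<longleftrightarrow> transpose A = A \<and> (\<forall>x. x \<noteq> 0 \<longrightarrow> x \<bullet> (A *v x) > 0)"

text \<open>In the index type \<^typ>\<open>4\<close> the numeral \<open>4\<close> denotes the same element as \<open>0\<close>;
  the four indices are nevertheless written \<open>1, 2, 3, 4\<close>.\<close>

lemma vector_4:
  "(vector [a, b, c, d] :: 'a::zero ^ 4) $ 1 = a"
  "(vector [a, b, c, d] :: 'a::zero ^ 4) $ 2 = b"
  "(vector [a, b, c, d] :: 'a::zero ^ 4) $ 3 = c"
  "(vector [a, b, c, d] :: 'a::zero ^ 4) $ 4 = d"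
  by (simp_all add: vector_def)

definition block_diag :: "real ^ 2 ^ 2 \<Rightarrow> real ^ 2 ^ 2 \<Rightarrow> real ^ 4 ^ 4" where
  "block_diag U1 U2 = vector
     [vector [U1 $ 1 $ 1, U1 $ 1 $ 2, 0, 0],
      vector [U1 $ 2 $ 1, U1 $ 2 $ 2, 0, 0],
      vector [0, 0, U2 $ 1 $ 1, U2 $ 1 $ 2],
      vector [0, 0, U2 $ 2 $ 1, U2 $ 2 $ 2]]"

definition signature22 :: "real ^ 4 ^ 4 \<Rightarrow> bool" where
  "signature22 U \<longleftrightarrow>
     (\<exists>U1 U2. orthogonal_matrix U1 \<and> orthogonal_matrix U2 \<and> U = block_diag U1 U2)"

definition upper_right :: "real ^ 4 ^ 4 \<Rightarrow> real ^ 2 ^ 2" where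
  "upper_right A = vector [vector [A $ 1 $ 3, A $ 1 $ 4], vector [A $ 2 $ 3, A $ 2 $ 4]]"

definition lower_left :: "real ^ 4 ^ 4 \<Rightarrow> real ^ 2 ^ 2" where
  "lower_left A = vector [vector [A $ 3 $ 1, A $ 3 $ 2], vector [A $ 4 $ 1, A $ 4 $ 2]]"

definition nonpos_off_diagonal :: "real ^ 'n ^ 'n \<Rightarrow> bool" where
  "nonpos_off_diagonal A \<longleftrightarrow> (\<forall>i j. i \<noteq> j \<longrightarrow> A $ i $ j \<le> 0)"

definition eigenpair :: "real ^ 'n ^ 'n \<Rightarrow> real \<Rightarrow> real ^ 'n \<Rightarrow> bool" where
  "eigenpair A c v \<longleftrightarrow> v \<noteq> 0 \<and> A *v v = c *\<^sub>R v"

text \<open>An eigenvector for the largest eigenvalue. It is determined up to a nonzero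
  factor, except for a multiple of the identity (\<^term>\<open>mat c\<close> is \<open>c\<close> times the
  identity), where it is fixed to be \<open>(1, 0)\<close>.\<close>

definition top_eigenvector :: "real ^ 2 ^ 2 \<Rightarrow> real ^ 2 \<Rightarrow> bool" where
  "top_eigenvector A v \<longleftrightarrow>
     (if \<exists>c. A = mat c then v = vector [1, 0]
      else \<exists>c. eigenpair A c v \<and> (\<forall>d w. eigenpair A d w \<longrightarrow> d \<le> c))"


section \<open>The quantities attached to the inverse covariance matrix\<close>

definition conj_inverse :: "real ^ 4 ^ 4 \<Rightarrow> real ^ 2 ^ 2 \<Rightarrow> real ^ 2 ^ 2 \<Rightarrow> real ^ 4 ^ 4" where
  "conj_inverse \<Sigma> W1 W2 =
     transpose (block_diag W1 W2) ** matrix_inv \<Sigma> ** block_diag W1 W2"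

definition sign_condition :: "real ^ 4 ^ 4 \<Rightarrow> real ^ 2 \<Rightarrow> bool" where
  "sign_condition S v \<longleftrightarrow>
     v $ 2 * S $ 2 $ 4 * (v $ 2 * S $ 2 $ 4 + v $ 1 * S $ 1 $ 4) \<ge> 0"

text \<open>\<open>admissible \<Sigma> W1 W2 v\<close> says that the blocks \<open>W1\<close>, \<open>W2\<close> and the vector \<open>v\<close> are
  obtained from \<open>\<Sigma>\<close> as required: \<open>W1\<close>, \<open>W2\<close> diagonalise the diagonal blocks of the inverse of
  \<open>\<Sigma>\<close> with decreasing positive diagonals, and \<open>v\<close> is the top eigenvector belonging
  to \<open>W1\<close>. If \<open>W1\<close> or \<open>W2\<close> is completely arbitrary because a diagonal block is a multiple of
  the identity, the choice is fixed so that the sign condition holds, which is always possible.\<close>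

definition admissible ::
  "real ^ 4 ^ 4 \<Rightarrow> real ^ 2 ^ 2 \<Rightarrow> real ^ 2 ^ 2 \<Rightarrow> real ^ 2 \<Rightarrow> bool" where
  "admissible \<Sigma> W1 W2 v \<longleftrightarrow>
     (let S = conj_inverse \<Sigma> W1 W2; P = matrix_inv \<Sigma> in
      orthogonal_matrix W1 \<and> orthogonal_matrix W2 \<and>
      S $ 1 $ 2 = 0 \<and> S $ 2 $ 1 = 0 \<and> S $ 3 $ 4 = 0 \<and> S $ 4 $ 3 = 0 \<and>
      S $ 1 $ 1 \<ge> S $ 2 $ 2 \<and> S $ 2 $ 2 > 0 \<and>
      S $ 3 $ 3 \<ge> S $ 4 $ 4 \<and> S $ 4 $ 4 > 0 \<and>
      top_eigenvector (transpose W1 ** upper_right P ** lower_left P ** W1) v \<and>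
      (S $ 1 $ 1 = S $ 2 $ 2 \<or> S $ 3 $ 3 = S $ 4 $ 4 \<longrightarrow> sign_condition S v))"


section \<open>Gaussian vectors and infinite divisibility\<close>

text \<open>Gaussian vectors are defined through their one-dimensional linear forms; the second
  disjunct is the degenerate normal law concentrated at \<open>m\<close>.\<close>

definition gaussian_vector :: "'a measure \<Rightarrow> ('a \<Rightarrow> real ^ 'n) \<Rightarrow> bool" where
  "gaussian_vector M X \<longleftrightarrow>
     X \<in> borel_measurable M \<and>
     (\<forall>t. (\<exists>m s. s > 0 \<and> distributed M lborel (\<lambda>\<omega>. t \<bullet> X \<omega>) (\<lambda>x. ennreal (normal_density m s x)))
        \<or> (\<exists>m. AE \<omega> in M. t \<bullet> X \<omega> = m))"

definition mean_zero :: "'a measure \<Rightarrow> ('a \<Rightarrow> real ^ 'n) \<Rightarrow> bool" where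
  "mean_zero M X \<longleftrightarrow> (\<forall>i. integral\<^sup>L M (\<lambda>\<omega>. X \<omega> $ i) = 0)"

definition covariance_matrix :: "'a measure \<Rightarrow> ('a \<Rightarrow> real ^ 'n) \<Rightarrow> real ^ 'n ^ 'n" where
  "covariance_matrix M X = (\<chi> i j. integral\<^sup>L M (\<lambda>\<omega>.
     (X \<omega> $ i - integral\<^sup>L M (\<lambda>\<omega>. X \<omega> $ i)) * (X \<omega> $ j - integral\<^sup>L M (\<lambda>\<omega>. X \<omega> $ j))))"

text \<open>The i.i.d. summands may live on another probability space; since only their joint law
  matters, its sample space can be taken to be the space of sequences.\<close>

definition infinitely_divisible :: "'a measure \<Rightarrow> ('a \<Rightarrow> real ^ 'n) \<Rightarrow> bool" where
  "infinitely_divisible M X \<longleftrightarrow>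
     (\<forall>n::nat. n \<ge> 1 \<longrightarrow> (\<exists>(N :: (nat \<Rightarrow> real ^ 'n) measure) Y.
        prob_space N \<and>
        prob_space.indep_vars N (\<lambda>_. borel) Y {..<n} \<and>
        (\<forall>i<n. \<forall>j<n. distr N borel (Y i) = distr N borel (Y j)) \<and>
        distr M borel X = distr N borel (\<lambda>\<omega>. \<Sum>i<n. Y i \<omega>)))"

end

theory Submission
  imports Defs
begin

text \<open>
  \<^bold>\<open>The equivalence.\<close> Let \<open>S\<close> be the inverse covariance matrix in the basis given by \<open>W1\<close>, \<open>W2\<close>, and \<open>B\<close>
  its upper right block. A signature matrix amounts to two orthonormal frames of the plane. The diagonal
  blocks of \<open>S\<close> are diagonal. If each of them has two different entries, in decreasing order, they become
  nonpositive off the diagonal exactly if the two vectors of a frame have second coordinates of equal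
  sign, that is, if the right-angled cone spanned by the frame contains \<open>(0, 1)\<close> or \<open>(0, -1)\<close> (lemma
  \<open>nonpos_off_diagonal_congruence\<close>); if a block has equal entries, the inequality holds by the choice of
  \<open>W1\<close>, \<open>W2\<close>. In addition, the bilinear form \<open>B\<close> has to be nonpositive on the product of the two cones. If it
  is, then by Perron-Frobenius the cones contain the top singular vectors of \<open>B\<close> up to sign; comparing
  the signs of their second coordinates with the sign of \<open>B $ 2 $ 2\<close> gives the inequality, because
  \<open>v $ 2 * B $ 2 $ 2 + v $ 1 * B $ 1 $ 2\<close> is the second coordinate of \<open>transpose B *v v\<close>, a multiple of the
  right singular vector (lemma \<open>sign_of_nonpositive_form\<close>). Conversely, given the inequality, suitable frames
  can be written down in terms of the singular vectors (lemma \<open>singular_sign_pattern\<close>).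

  \<^bold>\<open>Infinite divisibility.\<close> Let \<open>Q\<close> be the inverse covariance matrix. The Laplace transform of the vector of
  squares is \<open>(det (Q + L) / det Q) powr (- 1 / 2)\<close>, where \<open>L\<close> is diagonal and carries twice the
  variables (lemma \<open>gaussian_squares_transform\<close>). For the two sums of squares, \<open>L\<close> is constant on the two groups
  of coordinates and commutes with signature matrices, so \<open>Q\<close> may be assumed to have nonpositive
  off-diagonal entries. Then every power \<open>det (Q + L) powr (- \<alpha>)\<close> with \<open>\<alpha> > 0\<close> is the Laplace transform of a
  finite measure on the nonnegative orthant: symmetric Gaussian elimination writes the determinant as a
  product of pivots \<open>d + \<theta> $ i - g\<close>, where \<open>g\<close> is built from negated off-diagonal entries and inverse
  pivots by sums and products, hence is itself such a transform; and \<open>(d + \<theta> $ i - g) powr (- \<alpha>)\<close> is a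
  gamma transform times a binomial series with nonnegative coefficients in \<open>g / (d + \<theta> $ i)\<close> (lemma
  \<open>laplace_class_det_eliminate\<close>). The choice \<open>\<alpha> = 1 / (2 * n)\<close> yields the \<open>n\<close>-th convolution root, by
  uniqueness of Laplace transforms on the orthant (lemma \<open>laplace_transform_unique\<close>).
\<close>

section \<open>Laplace transforms of finite measures on the orthant\<close>

lemma borel_measurable_vec_component:
  fixes X :: "'a \<Rightarrow> real ^ 'n"
  assumes "X \<in> borel_measurable M"
  shows "(\<lambda>\<omega>. X \<omega> $ i) \<in> borel_measurable M"
  using borel_measurable_inner[OF assms borel_measurable_const[of "axis i 1"]] by (simp add: inner_axis)

lemma pred_vec_nonneg [measurable]: "Measurable.pred borel (\<lambda>x :: real ^ 'n. 0 \<le> x)"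
proof -
  have [measurable]: "(\<lambda>x :: real ^ 'n. x $ i) \<in> borel_measurable borel" for i
    by (rule borel_measurable_vec_component) simp
  show ?thesis unfolding less_eq_vec_def by measurable
qed

text \<open>The Laplace transforms of finite measures on the orthant of nonnegative vectors. The measure
  is split into its total mass \<open>C\<close> and a probability measure, because mixtures of probability measures
  are available as monadic binds. Values outside the orthant are arbitrary.\<close>

definition laplace_class :: "(real ^ 'n \<Rightarrow> real) \<Rightarrow> bool" where
  "laplace_class f \<longleftrightarrow> (\<exists>C \<mu>. 0 \<le> C \<and> prob_space \<mu> \<and> sets \<mu> = sets borel \<and> (AE x in \<mu>. 0 \<le> x) \<and>
     (\<forall>\<theta>\<ge>0. 0 \<le> f \<theta> \<and> ennreal (f \<theta>) = ennreal C * (\<integral>\<^sup>+x. ennreal (exp (- (\<theta> \<bullet> x))) \<partial>\<mu>)))"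

lemma laplace_class_nonneg: "laplace_class f \<Longrightarrow> 0 \<le> \<theta> \<Longrightarrow> 0 \<le> f \<theta>"
  by (auto simp: laplace_class_def)

lemma laplace_class_const:
  assumes "0 \<le> c"
  shows "laplace_class (\<lambda>_. c)"
  unfolding laplace_class_def
  by (rule exI[of _ c], rule exI[of _ "return borel 0"])
     (use assms in \<open>auto simp: prob_space_return AE_return nn_integral_return\<close>)

lemma laplace_class_cong:
  assumes "laplace_class f" "\<And>\<theta>. 0 \<le> \<theta> \<Longrightarrow> f \<theta> = g \<theta>"
  shows "laplace_class g"
  using assms unfolding laplace_class_def by metis

text \<open>The product belongs to the sum of two independent vectors.\<close>

lemma laplace_class_mult:
  fixes f g :: "real ^ 'n \<Rightarrow> real"
  assumes "laplace_class f" "laplace_class g"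
  shows "laplace_class (\<lambda>\<theta>. f \<theta> * g \<theta>)"
proof -
  obtain C \<mu> where \<mu>: "0 \<le> C" "prob_space \<mu>" "sets \<mu> = sets borel" "AE x in \<mu>. 0 \<le> x"
    "\<And>\<theta>. 0 \<le> \<theta> \<Longrightarrow> 0 \<le> f \<theta>"
    "\<And>\<theta>. 0 \<le> \<theta> \<Longrightarrow> ennreal (f \<theta>) = ennreal C * (\<integral>\<^sup>+x. ennreal (exp (- (\<theta> \<bullet> x))) \<partial>\<mu>)"
    using assms(1) unfolding laplace_class_def by blast
  obtain D \<nu> where \<nu>: "0 \<le> D" "prob_space \<nu>" "sets \<nu> = sets borel" "AE x in \<nu>. 0 \<le> x"
    "\<And>\<theta>. 0 \<le> \<theta> \<Longrightarrow> 0 \<le> g \<theta>"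
    "\<And>\<theta>. 0 \<le> \<theta> \<Longrightarrow> ennreal (g \<theta>) = ennreal D * (\<integral>\<^sup>+x. ennreal (exp (- (\<theta> \<bullet> x))) \<partial>\<nu>)"
    using assms(2) unfolding laplace_class_def by blast
  note [measurable_cong] = \<mu>(3) \<nu>(3)
  interpret \<mu>: prob_space \<mu> by fact
  interpret \<nu>: prob_space \<nu> by fact
  interpret pair_prob_space \<mu> \<nu> ..
  let ?\<kappa> = "distr (\<mu> \<Otimes>\<^sub>M \<nu>) borel (\<lambda>(x, y). x + y)"
  have AE_sum: "AE z in \<mu> \<Otimes>\<^sub>M \<nu>. 0 \<le> fst z + snd z"
  proof (rule AE_pair_measure)
    show "{z \<in> space (\<mu> \<Otimes>\<^sub>M \<nu>). 0 \<le> fst z + snd z} \<in> sets (\<mu> \<Otimes>\<^sub>M \<nu>)" by measurable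
    show "AE x in \<mu>. AE y in \<nu>. 0 \<le> fst (x, y) + snd (x, y)"
      using \<mu>(4)
    proof eventually_elim
      case (elim x)
      show ?case using \<nu>(4) by eventually_elim (use elim in simp)
    qed
  qed
  show ?thesis
    unfolding laplace_class_def
  proof (intro exI conjI allI impI)
    show "0 \<le> C * D" using \<mu>(1) \<nu>(1) by simp
    show "prob_space ?\<kappa>" by (intro prob_space_distr) measurable
    show "sets ?\<kappa> = sets borel" by simp
    show "AE x in ?\<kappa>. 0 \<le> x"
    proof (subst AE_distr_iff)
      show "AE z in \<mu> \<Otimes>\<^sub>M \<nu>. 0 \<le> (case z of (x, y) \<Rightarrow> x + y)"
        using AE_sum by (simp add: case_prod_beta)
    qed measurable
    fix \<theta> :: "real ^ 'n"
    assume \<theta>: "0 \<le> \<theta>"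
    show "0 \<le> f \<theta> * g \<theta>" using \<mu>(5)[OF \<theta>] \<nu>(5)[OF \<theta>] by simp
    have "(\<integral>\<^sup>+x. ennreal (exp (- (\<theta> \<bullet> x))) \<partial>?\<kappa>)
        = (\<integral>\<^sup>+z. ennreal (exp (- (\<theta> \<bullet> (fst z + snd z)))) \<partial>(\<mu> \<Otimes>\<^sub>M \<nu>))"
      by (subst nn_integral_distr) (auto simp: case_prod_beta)
    also have "\<dots> = (\<integral>\<^sup>+x. \<integral>\<^sup>+y. ennreal (exp (- (\<theta> \<bullet> x))) * ennreal (exp (- (\<theta> \<bullet> y))) \<partial>\<nu> \<partial>\<mu>)"
      by (subst \<nu>.nn_integral_fst[symmetric])
         (auto simp: inner_add_right ennreal_mult[symmetric] exp_add[symmetric])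
    also have "\<dots> = (\<integral>\<^sup>+x. ennreal (exp (- (\<theta> \<bullet> x))) \<partial>\<mu>) * (\<integral>\<^sup>+y. ennreal (exp (- (\<theta> \<bullet> y))) \<partial>\<nu>)"
      by (simp add: nn_integral_cmult nn_integral_multc)
    finally show "ennreal (f \<theta> * g \<theta>) = ennreal (C * D) * (\<integral>\<^sup>+x. ennreal (exp (- (\<theta> \<bullet> x))) \<partial>?\<kappa>)"
      using \<mu>(1,5,6) \<nu>(1,5,6) \<theta> by (simp add: ennreal_mult mult_ac)
  qed
qed

text \<open>A series of transforms is the transform of a mixture: the \<open>j\<close>-th summand is chosen with
  probability \<open>f j 0 / F 0\<close>, since the value of a transform at \<open>0\<close> is the total mass.\<close>

lemma laplace_class_sums:
  fixes f :: "nat \<Rightarrow> real ^ 'n \<Rightarrow> real"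
  assumes K: "\<And>j. laplace_class (f j)" and sums: "\<And>\<theta>. 0 \<le> \<theta> \<Longrightarrow> (\<lambda>j. f j \<theta>) sums F \<theta>"
  shows "laplace_class F"
proof -
  have "\<forall>j. \<exists>C \<mu>. 0 \<le> C \<and> prob_space \<mu> \<and> sets \<mu> = sets borel \<and> (AE x in \<mu>. 0 \<le> x) \<and>
     (\<forall>\<theta>\<ge>0. 0 \<le> f j \<theta> \<and> ennreal (f j \<theta>) = ennreal C * (\<integral>\<^sup>+x. ennreal (exp (- (\<theta> \<bullet> x))) \<partial>\<mu>))"
    using K unfolding laplace_class_def by blast
  then obtain C \<mu> where C: "\<And>j. 0 \<le> C j"
    and \<mu>: "\<And>j. prob_space (\<mu> j)" "\<And>j. sets (\<mu> j) = sets borel" "\<And>j. AE x in \<mu> j. 0 \<le> x"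
    and f: "\<And>j \<theta>. 0 \<le> \<theta> \<Longrightarrow> 0 \<le> f j \<theta>"
    "\<And>j \<theta>. 0 \<le> \<theta> \<Longrightarrow> ennreal (f j \<theta>) = ennreal (C j) * (\<integral>\<^sup>+x. ennreal (exp (- (\<theta> \<bullet> x))) \<partial>\<mu> j)"
    by metis
  have C_eq: "C j = f j 0" for j
  proof -
    interpret prob_space "\<mu> j" by fact
    show ?thesis using f[of 0 j] C[of j] by (simp add: emeasure_space_1)
  qed
  have C_sums: "C sums F 0" using sums[of 0] by (simp add: C_eq[abs_def])
  have F0: "0 \<le> F 0" using sums_le[OF _ sums_zero C_sums] C by simp
  have F_nonneg: "0 \<le> F \<theta>" if "0 \<le> \<theta>" for \<theta> 
    using sums_le[OF _ sums_zero sums[OF that]] f(1)[OF that] by simp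
  show ?thesis
  proof (cases "F 0 = 0")
    case True
    then have "C j = 0" for j
      using C_sums C suminf_eq_zero_iff[of C] by (simp add: sums_iff)
    then have f0: "f j \<theta> = 0" if "0 \<le> \<theta>" for j \<theta> using f[OF that, of j] by simp
    have F_zero: "0 = F \<theta>" if "0 \<le> \<theta>" for \<theta>
      using sums[OF that] by (simp add: f0[OF that] sums_iff)
    show ?thesis
      by (rule laplace_class_cong[OF laplace_class_const[of 0]]) (simp_all add: F_zero)
  next
    case False
    with F0 have pos: "0 < F 0" by simp
    define p where "p = embed_pmf (\<lambda>j. C j / F 0)"
    have pmf_p: "pmf p j = C j / F 0" for j
      unfolding p_def
    proof (rule pmf_embed_pmf)
      have "(\<lambda>j. C j / F 0) sums (F 0 / F 0)" using C_sums by (rule sums_divide)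
      then show "(\<integral>\<^sup>+j. ennreal (C j / F 0) \<partial>count_space UNIV) = 1"
        using pos C by (subst nn_integral_count_space_nat, subst suminf_ennreal_eq) auto
    qed (use C pos in auto)
    let ?\<kappa> = "measure_pmf p \<bind> \<mu>"
    have ker: "\<mu> \<in> measurable (measure_pmf p) (subprob_algebra borel)"
      using \<mu> by (auto simp: space_subprob_algebra intro: prob_space_imp_subprob_space)
    show ?thesis
      unfolding laplace_class_def
    proof (intro exI conjI allI impI)
      show "0 \<le> F 0" by fact
      show "prob_space ?\<kappa>"
        using \<mu>(1) ker by (intro measure_pmf.prob_space_bind[where S=borel]) auto
      show "sets ?\<kappa> = sets borel" using \<mu>(2) by (simp)
      show "AE x in ?\<kappa>. 0 \<le> x"
        using ker \<mu>(3) by (subst AE_bind[where B=borel]) auto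
      fix \<theta> :: "real ^ 'n"
      assume \<theta>: "0 \<le> \<theta>"
      show "0 \<le> F \<theta>" by (rule F_nonneg[OF \<theta>])
      have "(\<integral>\<^sup>+x. ennreal (exp (- (\<theta> \<bullet> x))) \<partial>?\<kappa>)
          = (\<integral>\<^sup>+j. \<integral>\<^sup>+x. ennreal (exp (- (\<theta> \<bullet> x))) \<partial>\<mu> j \<partial>measure_pmf p)"
        using ker by (intro nn_integral_bind[where B=borel]) auto
      also have "\<dots> = (\<Sum>j. ennreal (C j / F 0) * (\<integral>\<^sup>+x. ennreal (exp (- (\<theta> \<bullet> x))) \<partial>\<mu> j))"
        by (simp add: nn_integral_measure_pmf nn_integral_count_space_nat pmf_p)
      also have "\<dots> = (\<Sum>j. ennreal (f j \<theta> / F 0))"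
      proof (intro suminf_cong)
        fix j
        have "ennreal (C j / F 0) = ennreal (1 / F 0) * ennreal (C j)"
          using pos C by (simp add: ennreal_mult[symmetric])
        then have "ennreal (C j / F 0) * (\<integral>\<^sup>+x. ennreal (exp (- (\<theta> \<bullet> x))) \<partial>\<mu> j) = ennreal (1 / F 0) * ennreal (f j \<theta>)"
          by (simp only: mult.assoc f(2)[OF \<theta>])
        also have "\<dots> = ennreal (f j \<theta> / F 0)"
          using f(1)[OF \<theta>, of j] pos by (subst ennreal_mult[symmetric]) auto
        finally show "ennreal (C j / F 0) * (\<integral>\<^sup>+x. ennreal (exp (- (\<theta> \<bullet> x))) \<partial>\<mu> j) = ennreal (f j \<theta> / F 0)" .
      qed
      also have "\<dots> = ennreal (F \<theta> / F 0)"
        using sums_divide[OF sums[OF \<theta>], of "F 0"] f(1)[OF \<theta>] pos by (subst suminf_ennreal_eq) auto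
      finally show "ennreal (F \<theta>) = ennreal (F 0) * (\<integral>\<^sup>+x. ennreal (exp (- (\<theta> \<bullet> x))) \<partial>?\<kappa>)"
        using pos F_nonneg[OF \<theta>] by (simp add: ennreal_mult[symmetric])
    qed
  qed
qed


lemma laplace_class_add:
  assumes "laplace_class f" "laplace_class g"
  shows "laplace_class (\<lambda>\<theta>. f \<theta> + g \<theta>)"
proof (rule laplace_class_sums)
  show "laplace_class (\<lambda>\<theta>. if j = 0 then f \<theta> else if j = 1 then g \<theta> else 0)" for j :: nat
    using assms laplace_class_const[of 0] by (cases "j = 0"; cases "j = 1") simp_all
  show "(\<lambda>j::nat. if j = 0 then f \<theta> else if j = 1 then g \<theta> else 0) sums (f \<theta> + g \<theta>)" for \<theta>
    using sums_finite[of "{0, 1 :: nat}" "\<lambda>j. if j = 0 then f \<theta> else if j = 1 then g \<theta> else 0"] by simp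
qed

lemma laplace_class_prod:
  assumes "finite I" "\<And>i. i \<in> I \<Longrightarrow> laplace_class (f i)"
  shows "laplace_class (\<lambda>\<theta>. \<Prod>i\<in>I. f i \<theta>)"
  using assms by (induction I rule: finite_induct) (auto intro: laplace_class_const laplace_class_mult)

lemma laplace_class_power:
  assumes "laplace_class f"
  shows "laplace_class (\<lambda>\<theta>. f \<theta> ^ k)"
  using assms by (induction k) (auto intro: laplace_class_const laplace_class_mult)

text \<open>The binomial series of \<open>(1 - x) powr (- \<alpha>)\<close> has nonnegative coefficients. This is what makes
  arbitrarily small powers, and hence roots of every order, stay inside the class.\<close>

lemma laplace_class_one_minus_powr:
  assumes g: "laplace_class g" "\<And>\<theta>. 0 \<le> \<theta> \<Longrightarrow> g \<theta> < 1" and "0 < \<alpha>"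
  shows "laplace_class (\<lambda>\<theta>. (1 - g \<theta>) powr (- \<alpha>))"
proof (rule laplace_class_sums)
  show "laplace_class (\<lambda>\<theta>. pochhammer \<alpha> k / fact k * g \<theta> ^ k)" for k
    using \<open>0 < \<alpha>\<close> pochhammer_pos[of \<alpha> k]
    by (intro laplace_class_mult laplace_class_const laplace_class_power g) auto
next
  fix \<theta> :: "real ^ 'a"
  assume \<theta>: "0 \<le> \<theta>"
  have "(\<lambda>k. (- \<alpha> gchoose k) * (- g \<theta>) ^ k) sums (1 + (- g \<theta>)) powr (- \<alpha>)"
    using g \<theta> laplace_class_nonneg[OF g(1) \<theta>] by (intro gen_binomial_real) auto
  moreover have "(- \<alpha> gchoose k) * (- g \<theta>) ^ k = pochhammer \<alpha> k / fact k * g \<theta> ^ k" for k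
    by (simp add: gbinomial_pochhammer power_minus[of "g \<theta>"])
  ultimately show "(\<lambda>k. pochhammer \<alpha> k / fact k * g \<theta> ^ k) sums (1 - g \<theta>) powr (- \<alpha>)"
    by simp
qed

lemma nn_integral_gamma_scaled:
  assumes "0 < s" "0 < (\<alpha>::real)"
  shows "(\<integral>\<^sup>+t. ennreal (indicator {0..} t * t powr (\<alpha> - 1) * exp (- (s * t))) \<partial>lborel) = ennreal (Gamma \<alpha> * s powr (- \<alpha>))"
proof -
  let ?f = "\<lambda>t::real. ennreal (indicator {0..} t * t powr (\<alpha> - 1) * exp (- (s * t)))"
  have "(\<integral>\<^sup>+t. ?f t \<partial>lborel) = ennreal \<bar>1 / s\<bar> * (\<integral>\<^sup>+t. ?f (0 + 1 / s * t) \<partial>lborel)"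
    using assms by (intro nn_integral_real_affine) auto
  also have "(\<lambda>t. ?f (0 + 1 / s * t)) = (\<lambda>t. ennreal ((1 / s) powr (\<alpha> - 1)) * ennreal (indicator {0..} t * t powr (\<alpha> - 1) / exp t))"
  proof
    fix t :: real
    show "?f (0 + 1 / s * t) = ennreal ((1 / s) powr (\<alpha> - 1)) * ennreal (indicator {0..} t * t powr (\<alpha> - 1) / exp t)"
    proof (cases "0 \<le> t")
      case True
      then have "(1 / s * t) powr (\<alpha> - 1) = (1 / s) powr (\<alpha> - 1) * t powr (\<alpha> - 1)"
        using assms by (intro powr_mult)
      moreover have "exp (- (s * (1 / s * t))) = 1 / exp t"
        using assms by (simp add: exp_minus inverse_eq_divide)
      ultimately show ?thesis
        using True assms by (simp add: ennreal_mult[symmetric] indicator_def)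
    next
      case False
      then show ?thesis
        using assms by (simp add: indicator_def zero_le_divide_iff)
    qed
  qed
  also have "ennreal \<bar>1 / s\<bar> * (\<integral>\<^sup>+t. ennreal ((1 / s) powr (\<alpha> - 1)) * ennreal (indicator {0..} t * t powr (\<alpha> - 1) / exp t) \<partial>lborel)
      = ennreal (1 / s) * (ennreal ((1 / s) powr (\<alpha> - 1)) * ennreal (Gamma \<alpha>))"
    using assms by (simp add: nn_integral_cmult Gamma_conv_nn_integral_real)
  also have "\<dots> = ennreal (Gamma \<alpha> * s powr (- \<alpha>))"
    using assms Gamma_real_pos[of \<alpha>]
    by (simp add: ennreal_mult[symmetric] powr_divide powr_minus powr_diff field_simps)
  finally show ?thesis .
qed

text \<open>The gamma distribution with shape \<open>\<alpha>\<close> and rate \<open>d\<close>, placed on the \<open>i\<close>-th coordinate axis.\<close>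

lemma laplace_class_gamma:
  fixes i :: "'n::finite"
  assumes "0 < d" "0 < \<alpha>"
  shows "laplace_class (\<lambda>\<theta>::real ^ 'n. (d + \<theta> $ i) powr (- \<alpha>))"
proof -
  define q where "q t = d powr \<alpha> / Gamma \<alpha> * (indicator {0..} t * t powr (\<alpha> - 1) * exp (- (d * t)))" for t :: real
  have q_meas [measurable]: "q \<in> borel_measurable borel" unfolding q_def by measurable
  have ax [measurable]: "(\<lambda>t::real. axis i t :: real ^ 'n) \<in> borel_measurable borel"
  proof -
    have "(\<lambda>t::real. t *\<^sub>R (axis i 1 :: real ^ 'n)) \<in> borel_measurable borel" by measurable
    then show ?thesis
      by (rule subst[of _ _ "\<lambda>h. h \<in> borel_measurable borel", rotated])
         (simp add: fun_eq_iff vec_eq_iff axis_def)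
  qed
  have q_nonneg: "0 \<le> q t" for t
    using assms Gamma_real_pos[of \<alpha>] by (auto simp: q_def)
  have q_int: "(\<integral>\<^sup>+t. ennreal (q t) * ennreal (exp (- (u * t))) \<partial>lborel) = ennreal (d powr \<alpha> * (d + u) powr (- \<alpha>))"
    if "0 \<le> u" for u
  proof -
    have "ennreal (q t) * ennreal (exp (- (u * t)))
        = ennreal (d powr \<alpha> / Gamma \<alpha>) * ennreal (indicator {0..} t * t powr (\<alpha> - 1) * exp (- ((d + u) * t)))" for t
    proof -
      have e: "exp (- ((d + u) * t)) = exp (- (d * t)) * exp (- (u * t))"
        by (simp add: distrib_right flip: exp_add)
      have "q t * exp (- (u * t)) = d powr \<alpha> / Gamma \<alpha> * (indicator {0..} t * t powr (\<alpha> - 1) * exp (- ((d + u) * t)))"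
        unfolding e q_def by (simp only: mult.assoc)
      moreover have "0 \<le> d powr \<alpha> / Gamma \<alpha>"
        using assms Gamma_real_pos[of \<alpha>] by simp
      ultimately show ?thesis
        using q_nonneg[of t] by (metis ennreal_mult' ennreal_mult'' exp_ge_zero)
    qed
    then have "(\<integral>\<^sup>+t. ennreal (q t) * ennreal (exp (- (u * t))) \<partial>lborel)
        = ennreal (d powr \<alpha> / Gamma \<alpha>) * ennreal (Gamma \<alpha> * (d + u) powr (- \<alpha>))"
      using assms that by (simp add: nn_integral_cmult nn_integral_gamma_scaled)
    then show ?thesis
      using assms Gamma_real_pos[OF assms(2)] by (simp add: ennreal_mult[symmetric])
  qed
  let ?\<mu> = "distr (density lborel q) borel (\<lambda>t. axis i t :: real ^ 'n)"
  show ?thesis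
    unfolding laplace_class_def
  proof (intro exI conjI allI impI)
    show "0 \<le> d powr (- \<alpha>)" by simp
    have "emeasure (density lborel q) (space (density lborel q)) = 1"
      using q_int[of 0] assms by (simp add: emeasure_density powr_minus)
    then have "prob_space (density lborel q)" by (rule prob_spaceI)
    then show "prob_space ?\<mu>" by (rule prob_space.prob_space_distr) measurable
    show "sets ?\<mu> = sets borel" by simp
    show "AE x in ?\<mu>. 0 \<le> x"
    proof (subst AE_distr_iff)
      have "q t = 0" if "\<not> 0 \<le> t" for t
        using that by (simp add: q_def)
      then have "0 \<le> (axis i t :: real ^ 'n)" if "0 < ennreal (q t)" for t
        using that by (cases "0 \<le> t") (auto simp: less_eq_vec_def axis_def)
      then show "AE t in density lborel q. 0 \<le> (axis i t :: real ^ 'n)"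
        by (simp add: AE_density)
    qed measurable
    fix \<theta> :: "real ^ 'n"
    assume \<theta>: "0 \<le> \<theta>"
    then have \<theta>i: "0 \<le> \<theta> $ i" by (simp add: less_eq_vec_def)
    show "0 \<le> (d + \<theta> $ i) powr (- \<alpha>)" by simp
    have "(\<integral>\<^sup>+x. ennreal (exp (- (\<theta> \<bullet> x))) \<partial>?\<mu>) = ennreal (d powr \<alpha> * (d + \<theta> $ i) powr (- \<alpha>))"
      using q_int[OF \<theta>i] by (simp add: nn_integral_distr nn_integral_density inner_axis)
    then show "ennreal ((d + \<theta> $ i) powr (- \<alpha>)) = ennreal (d powr (- \<alpha>)) * (\<integral>\<^sup>+x. ennreal (exp (- (\<theta> \<bullet> x))) \<partial>?\<mu>)"
      using assms by (simp add: ennreal_mult[symmetric] powr_minus)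
  qed
qed

text \<open>Pivots of a matrix whose diagonal carries the variables have this form. Factoring out
  \<open>d + \<theta> $ i\<close>, whose negative powers are gamma transforms, leaves \<open>1 - h\<close> with \<open>h = g / (d + \<theta> $ i)\<close> in the
  class. Positivity of the pivot says \<open>h < 1\<close>, so that the binomial series converges.\<close>

lemma laplace_class_pivot_powr:
  fixes i :: "'n::finite" and g :: "real ^ 'n \<Rightarrow> real"
  assumes g: "laplace_class g" and "0 < d" "0 < \<alpha>"
    and pos: "\<And>\<theta>. 0 \<le> \<theta> \<Longrightarrow> 0 < d + \<theta> $ i - g \<theta>"
  shows "laplace_class (\<lambda>\<theta>. (d + \<theta> $ i - g \<theta>) powr (- \<alpha>))"
proof (rule laplace_class_cong)
  let ?h = "\<lambda>\<theta>. (d + \<theta> $ i) powr (- 1) * g \<theta>"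
  have lt: "?h \<theta> < 1" if "0 \<le> \<theta>" for \<theta>
    using pos[OF that] laplace_class_nonneg[OF g that]
    by (simp add: powr_minus_divide divide_less_eq_1)
  show "laplace_class (\<lambda>\<theta>. (d + \<theta> $ i) powr (- \<alpha>) * (1 - ?h \<theta>) powr (- \<alpha>))"
    using assms(2,3) lt
    by (intro laplace_class_mult laplace_class_gamma laplace_class_one_minus_powr g) auto
  fix \<theta> :: "real ^ 'n"
  assume \<theta>: "0 \<le> \<theta>"
  have d: "0 < d + \<theta> $ i"
    using pos[OF \<theta>] laplace_class_nonneg[OF g \<theta>] by linarith
  have "(d + \<theta> $ i) powr (- \<alpha>) * (1 - ?h \<theta>) powr (- \<alpha>) = ((d + \<theta> $ i) * (1 - ?h \<theta>)) powr (- \<alpha>)"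
    using lt[OF \<theta>] d by (simp add: powr_mult)
  also have "(d + \<theta> $ i) * (1 - ?h \<theta>) = d + \<theta> $ i - g \<theta>"
    using d by (simp add: powr_minus_divide field_simps)
  finally show "(d + \<theta> $ i) powr (- \<alpha>) * (1 - ?h \<theta>) powr (- \<alpha>) = (d + \<theta> $ i - g \<theta>) powr (- \<alpha>)" .
qed

section \<open>Symmetric Gaussian elimination\<close>

lemma positive_definite_sym: "positive_definite A \<Longrightarrow> A $ i $ j = A $ j $ i"
  unfolding positive_definite_def transpose_def by (metis vec_lambda_beta)

lemma positive_definite_diag_pos:
  assumes "positive_definite A"
  shows "0 < A $ i $ i"
proof -
  have "0 < axis i 1 \<bullet> (A *v axis i 1)"
    using assms by (simp add: positive_definite_def axis_eq_0_iff)
  then show ?thesis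
    by (simp add: inner_axis' matrix_vector_mult_basis column_def)
qed

lemma positive_definite_congruence:
  fixes A P :: "real ^ 'n ^ 'n"
  assumes "positive_definite A" and "det P \<noteq> 0"
  shows "positive_definite (transpose P ** A ** P)"
  unfolding positive_definite_def
proof (intro conjI allI impI)
  show "transpose (transpose P ** A ** P) = transpose P ** A ** P"
    using assms(1) by (simp add: positive_definite_def matrix_transpose_mul matrix_mul_assoc)
  fix x :: "real ^ 'n"
  assume "x \<noteq> 0"
  moreover have "invertible P" using assms(2) by (simp add: invertible_det_nz)
  ultimately have "P *v x \<noteq> 0"
    by (metis inj_matrix_vector_mult injD matrix_vector_mult_0_right)
  moreover have "x \<bullet> (transpose P *v y) = (P *v x) \<bullet> y" for y
    using dot_lmul_matrix[of x "transpose P" y] by (simp add: vector_transpose_matrix)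
  then have "x \<bullet> ((transpose P ** A ** P) *v x) = (P *v x) \<bullet> (A *v (P *v x))"
    by (simp flip: matrix_vector_mul_assoc)
  ultimately show "0 < x \<bullet> ((transpose P ** A ** P) *v x)"
    using assms(1) by (simp add: positive_definite_def)
qed

text \<open>One step of symmetric Gaussian elimination: the \<open>k\<close>-th row and column are cleared outside the
  pivot, and the remaining block is replaced by its Schur complement.\<close>

definition eliminate :: "'n \<Rightarrow> real ^ 'n ^ 'n \<Rightarrow> real ^ 'n ^ 'n" where
  "eliminate k A = (\<chi> i j. if i = k \<or> j = k then if i = j then A $ k $ k else 0
                             else A $ i $ j - A $ i $ k * A $ k $ j / A $ k $ k)"

text \<open>Because elimination is a congruence by a matrix of determinant \<open>1\<close>, it changes neither
  the determinant nor positive definiteness.\<close>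

lemma eliminate_congruence:
  fixes A :: "real ^ 'n ^ 'n"
  assumes A: "positive_definite A"
  obtains P where "det P = 1" "eliminate k A = transpose P ** A ** P"
proof
  define c where "c i = (if i = k then 0 else A $ i $ k / A $ k $ k)" for i
  define P :: "real ^ 'n ^ 'n" where "P = (\<chi> i j. (if i = j then 1 else 0) - (if i = k then c j else 0))"
  have kk: "A $ k $ k \<noteq> 0" using positive_definite_diag_pos[OF A, of k] by simp
  \<comment> \<open>\<open>transpose P\<close> is the identity with its \<open>k\<close>-th column replaced, so Cramer's rule applies\<close>
  define x :: "real ^ 'n" where "x = (\<chi> i. if i = k then 1 else - c i)"
  have "det (transpose P) = det (\<chi> i j. if j = k then (mat 1 *v x) $ i else (mat 1 :: real ^ 'n ^ 'n) $ i $ j)"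
    unfolding matrix_vector_mul_lid
    by (rule arg_cong[of _ _ det]) (auto simp: vec_eq_iff transpose_def P_def x_def mat_def c_def)
  also have "\<dots> = 1" unfolding cramer_lemma by (simp add: x_def)
  finally show "det P = 1" by simp
  have "(transpose P ** A) $ i $ j = A $ i $ j - c i * A $ k $ j" for i j
    by (simp add: matrix_matrix_mult_def transpose_def P_def left_diff_distrib sum_subtractf if_distrib[of "\<lambda>x. x * _"] cong: if_cong)
  moreover have "(Q ** P) $ i $ j = Q $ i $ j - Q $ i $ k * c j" for Q :: "real ^ 'n ^ 'n" and i j
    by (simp add: matrix_matrix_mult_def P_def right_diff_distrib sum_subtractf if_distrib[of "\<lambda>x. _ * x"] cong: if_cong)
  ultimately have "(transpose P ** A ** P) $ i $ j = A $ i $ j - c i * A $ k $ j - (A $ i $ k - c i * A $ k $ k) * c j" for i j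
    by presburger
  then show "eliminate k A = transpose P ** A ** P"
    using kk positive_definite_sym[OF A]
    by (auto simp: vec_eq_iff eliminate_def c_def)
qed

lemma det_eliminate: "positive_definite A \<Longrightarrow> det (eliminate k A) = det A"
  by (metis eliminate_congruence det_mul det_transpose mult_1 mult.right_neutral)

lemma positive_definite_eliminate: "positive_definite A \<Longrightarrow> positive_definite (eliminate k A)"
  by (metis eliminate_congruence positive_definite_congruence zero_neq_one)

lemma eliminate_off_diagonal_zero:
  assumes "\<And>i j. i \<notin> insert k R \<Longrightarrow> i \<noteq> j \<Longrightarrow> A $ i $ j = 0" and "i \<notin> R" "i \<noteq> j"
  shows "eliminate k A $ i $ j = 0"
  using assms(1)[of i j] assms(1)[of i k] assms(2,3) by (cases "i = k") (auto simp: eliminate_def)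

text \<open>The pivots of a positive definite matrix are positive.\<close>

lemma positive_definite_det_pos:
  assumes "positive_definite A"
  shows "0 < det A"
proof -
  have "0 < det A" if "finite R" "positive_definite A" "\<And>i j. i \<notin> R \<Longrightarrow> i \<noteq> j \<Longrightarrow> A $ i $ j = 0"
    for R and A :: "real ^ 'n ^ 'n"
    using that
  proof (induction R arbitrary: A rule: finite_induct)
    case (empty A)
    then have "det A = (\<Prod>i\<in>UNIV. A $ i $ i)" by (intro det_diagonal) auto
    then show ?case using empty(1) by (simp add: prod_pos positive_definite_diag_pos)
  next
    case (insert k R A)
    have "0 < det (eliminate k A)"
      by (intro insert.IH positive_definite_eliminate eliminate_off_diagonal_zero[where R=R] insert.prems)
    then show ?case by (simp add: det_eliminate insert.prems(1))
  qed
  from this[of UNIV A] show ?thesis using assms by simp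
qed

text \<open>This is where nonpositive off-diagonal entries are used. Elimination subtracts
  \<open>A $ i $ k * A $ k $ j / A $ k $ k\<close>, a product of two entries of the same sign and a negative power of a
  pivot, hence a member of the class. So the class keeps containing the negated
  off-diagonal entries, and each diagonal entry stays of the form "constant plus variable minus
  member of the class". After all indices have been eliminated the determinant is the product of the
  pivots. The set \<open>R\<close> consists of the indices that are still to be eliminated; \<open>b i\<close> says which
  variable sits in the \<open>i\<close>-th diagonal entry.\<close>

lemma laplace_class_det_eliminate:
  fixes A :: "real ^ 'n \<Rightarrow> real ^ 'm ^ 'm" and b :: "'m \<Rightarrow> 'n"
  assumes "finite R" and \<alpha>: "0 < \<alpha>"
    and pd: "\<And>\<theta>. 0 \<le> \<theta> \<Longrightarrow> positive_definite (A \<theta>)"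
    and off: "\<And>i j. i \<noteq> j \<Longrightarrow> laplace_class (\<lambda>\<theta>. - A \<theta> $ i $ j)"
    and diag: "\<And>i. \<exists>d g. laplace_class g \<and> (\<forall>\<theta>\<ge>0. A \<theta> $ i $ i = d + \<theta> $ b i - g \<theta>)"
    and zero: "\<And>i j \<theta>. i \<notin> R \<Longrightarrow> i \<noteq> j \<Longrightarrow> 0 \<le> \<theta> \<Longrightarrow> A \<theta> $ i $ j = 0"
  shows "laplace_class (\<lambda>\<theta>. det (A \<theta>) powr (- \<alpha>))"
proof -
  have pivot: "laplace_class (\<lambda>\<theta>. A \<theta> $ i $ i powr (- \<beta>))"
    if "0 < \<beta>" and pd: "\<And>\<theta>. 0 \<le> \<theta> \<Longrightarrow> positive_definite (A \<theta>)"
      and diag: "\<exists>d g. laplace_class g \<and> (\<forall>\<theta>\<ge>0. A \<theta> $ i $ i = d + \<theta> $ b i - g \<theta>)"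
    for i \<beta> and A :: "real ^ 'n \<Rightarrow> real ^ 'm ^ 'm"
  proof -
    obtain d g where g: "laplace_class g" and eq: "\<And>\<theta>. 0 \<le> \<theta> \<Longrightarrow> A \<theta> $ i $ i = d + \<theta> $ b i - g \<theta>"
      using diag by blast
    have pos: "0 < d + \<theta> $ b i - g \<theta>" if "0 \<le> \<theta>" for \<theta>
      using positive_definite_diag_pos[OF pd[OF that], of i] eq[OF that] by simp
    have "0 < d"
      using pos[of 0] laplace_class_nonneg[OF g, of 0] by simp
    then show ?thesis
      by (intro laplace_class_cong[OF laplace_class_pivot_powr[OF g _ \<open>0 < \<beta>\<close> pos]]) (simp_all add: eq)
  qed
  show ?thesis
    using assms(1) pd off diag zero
  proof (induction R arbitrary: A rule: finite_induct)
    case (empty A)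
    show ?case
    proof (rule laplace_class_cong)
      show "laplace_class (\<lambda>\<theta>. \<Prod>i\<in>UNIV. A \<theta> $ i $ i powr (- \<alpha>))"
        using empty(1,3) by (intro laplace_class_prod pivot \<alpha>) auto
      fix \<theta> :: "real ^ 'n"
      assume \<theta>: "0 \<le> \<theta>"
      have "det (A \<theta>) = (\<Prod>i\<in>UNIV. A \<theta> $ i $ i)"
        using empty(4) \<theta> by (intro det_diagonal) auto
      then show "(\<Prod>i\<in>UNIV. A \<theta> $ i $ i powr (- \<alpha>)) = det (A \<theta>) powr (- \<alpha>)"
        using positive_definite_diag_pos[OF empty(1)[OF \<theta>]]
        by (simp add: prod_powr_distrib less_imp_le)
    qed
  next
    case (insert k R A)
    let ?A' = "\<lambda>\<theta>. eliminate k (A \<theta>)"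
    note pdA = insert.prems(1) and offA = insert.prems(2) and diagA = insert.prems(3) and zeroA = insert.prems(4)
    have kk: "laplace_class (\<lambda>\<theta>. A \<theta> $ k $ k powr (- 1))"
      by (rule pivot) (use pdA diagA in auto)
    have kpos: "0 < A \<theta> $ k $ k" if "0 \<le> \<theta>" for \<theta>
      using positive_definite_diag_pos[OF pdA[OF that]] .
    have fill: "laplace_class (\<lambda>\<theta>. A \<theta> $ i $ k * A \<theta> $ k $ j / A \<theta> $ k $ k)" if "i \<noteq> k" "k \<noteq> j" for i j
    proof (rule laplace_class_cong)
      show "laplace_class (\<lambda>\<theta>. - A \<theta> $ i $ k * - A \<theta> $ k $ j * A \<theta> $ k $ k powr (- 1))"
        using offA that kk by (intro laplace_class_mult) auto
    qed (use kpos in \<open>simp add: powr_minus_divide less_imp_le\<close>)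
    have "laplace_class (\<lambda>\<theta>. det (?A' \<theta>) powr (- \<alpha>))"
    proof (rule insert.IH)
      show "positive_definite (?A' \<theta>)" if "0 \<le> \<theta>" for \<theta>
        by (rule positive_definite_eliminate[OF pdA[OF that]])
      show "laplace_class (\<lambda>\<theta>. - ?A' \<theta> $ i $ j)" if "i \<noteq> j" for i j
      proof (cases "i = k \<or> j = k")
        case True
        then show ?thesis using that laplace_class_const[of 0] by (simp add: eliminate_def)
      next
        case False
        have "laplace_class (\<lambda>\<theta>. - A \<theta> $ i $ j + A \<theta> $ i $ k * A \<theta> $ k $ j / A \<theta> $ k $ k)"
          using False that by (intro laplace_class_add offA fill) auto
        then show ?thesis using False by (simp add: eliminate_def)
      qed
      show "\<exists>d g. laplace_class g \<and> (\<forall>\<theta>\<ge>0. ?A' \<theta> $ i $ i = d + \<theta> $ b i - g \<theta>)" for i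
      proof (cases "i = k")
        case True
        then show ?thesis using diagA[of k] by (simp add: eliminate_def)
      next
        case False
        obtain d g where g: "laplace_class g" "\<And>\<theta>. 0 \<le> \<theta> \<Longrightarrow> A \<theta> $ i $ i = d + \<theta> $ b i - g \<theta>"
          using diagA[of i] by blast
        have "laplace_class (\<lambda>\<theta>. g \<theta> + A \<theta> $ i $ k * A \<theta> $ k $ i / A \<theta> $ k $ k)"
          using False g(1) by (intro laplace_class_add fill) auto
        moreover have "?A' \<theta> $ i $ i = d + \<theta> $ b i - (g \<theta> + A \<theta> $ i $ k * A \<theta> $ k $ i / A \<theta> $ k $ k)" if "0 \<le> \<theta>" for \<theta>
          using False g(2)[OF that] by (simp add: eliminate_def)
        ultimately show ?thesis by blast
      qed
      show "?A' \<theta> $ i $ j = 0" if "i \<notin> R" "i \<noteq> j" "0 \<le> \<theta>" for i j \<theta>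
        using that zeroA by (intro eliminate_off_diagonal_zero[where R=R]) auto
    qed
    then show ?case
      by (rule laplace_class_cong) (simp add: det_eliminate pdA)
  qed
qed

section \<open>The Laplace transform of the squares of a Gaussian vector\<close>

lemma prob_space_std_normal: "prob_space std_normal_distribution"
  using prob_space_normal_density[of 1 0] by simp

lemma std_normal_integral_cos: "(\<integral>x. cos (a * x) \<partial>std_normal_distribution) = exp (- a\<^sup>2 / 2)"
  and std_normal_integral_sin: "(\<integral>x. sin (a * x) \<partial>std_normal_distribution) = 0"
proof -
  interpret N: prob_space std_normal_distribution by (rule prob_space_std_normal)
  have int: "integrable std_normal_distribution (\<lambda>x. iexp (a * x))"
    by (rule N.integrable_const_bound[where B=1]) auto
  have c: "(CLINT x|std_normal_distribution. iexp (a * x)) = complex_of_real (exp (- a\<^sup>2 / 2))"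
    using char_std_normal_distribution by (simp add: char_def fun_eq_iff)
  show "(\<integral>x. cos (a * x) \<partial>std_normal_distribution) = exp (- a\<^sup>2 / 2)"
    using integral_bounded_linear[OF bounded_linear_Re int] c by (simp add: Re_exp)
  show "(\<integral>x. sin (a * x) \<partial>std_normal_distribution) = 0"
    using integral_bounded_linear[OF bounded_linear_Im int] c by (simp add: Im_exp)
qed

lemma std_normal_integral_cos_shift:
  "(\<integral>x. cos (t + a * x) \<partial>std_normal_distribution) = cos t * exp (- a\<^sup>2 / 2)"
proof -
  interpret N: prob_space std_normal_distribution by (rule prob_space_std_normal)
  have "integrable std_normal_distribution (\<lambda>x. cos (a * x))" "integrable std_normal_distribution (\<lambda>x. sin (a * x))"
    by (rule N.integrable_const_bound[where B=1]; simp)+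
  then show ?thesis
    by (simp add: cos_add std_normal_integral_cos std_normal_integral_sin)
qed

text \<open>Completing the square, the integrand becomes a multiple of the normal density with mean
  \<open>- a / (1 + b)\<close> and variance \<open>1 / (1 + b)\<close>.\<close>

lemma std_normal_integral_exp_quadratic:
  assumes "0 \<le> b"
  shows "(\<integral>x. exp (- (a * x) - b * x\<^sup>2 / 2) \<partial>std_normal_distribution)
       = (1 + b) powr (- 1 / 2) * exp (a\<^sup>2 / (2 * (1 + b)))"
proof -
  define s where "s = 1 / sqrt (1 + b)"
  have s: "0 < s" "s\<^sup>2 = 1 / (1 + b)"
    using assms by (simp_all add: s_def power_divide)
  have "std_normal_density x * exp (- (a * x) - b * x\<^sup>2 / 2)
      = (s * exp (a\<^sup>2 / (2 * (1 + b)))) * normal_density (- a / (1 + b)) s x" for x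
  proof -
    have "- x\<^sup>2 / 2 + (- (a * x) - b * x\<^sup>2 / 2)
        = a\<^sup>2 / (2 * (1 + b)) + - (x - (- a / (1 + b)))\<^sup>2 / (2 * s\<^sup>2)"
    proof -
      define c where "c = 1 + b"
      define q where "q = a / c"
      have b: "b = c - 1" and a: "a = c * q" and c: "c > 0"
        using assms by (auto simp: c_def q_def)
      have 1: "a\<^sup>2 / (2 * (1 + b)) = c * q\<^sup>2 / 2"
        using c by (simp add: a b power2_eq_square)
      have 2: "- (x - (- a / (1 + b)))\<^sup>2 / (2 * s\<^sup>2) = - c * (x + q)\<^sup>2 / 2"
        using c unfolding s(2) by (simp add: a b)
      show ?thesis
        unfolding 1 2 by (simp add: a b power2_eq_square algebra_simps add_divide_distrib diff_divide_distrib)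
    qed
    then have "exp (- x\<^sup>2 / 2) * exp (- (a * x) - b * x\<^sup>2 / 2)
        = exp (a\<^sup>2 / (2 * (1 + b))) * exp (- (x - (- a / (1 + b)))\<^sup>2 / (2 * s\<^sup>2))"
      by (simp only: exp_add[symmetric])
    moreover have "1 / sqrt (2 * pi) = s * (1 / sqrt (2 * pi * s\<^sup>2))"
      using s(1) by (simp add: real_sqrt_mult)
    ultimately show ?thesis
      unfolding std_normal_density_def normal_density_def by (simp add: mult_ac)
  qed
  then have "(\<integral>x. exp (- (a * x) - b * x\<^sup>2 / 2) \<partial>std_normal_distribution)
      = (s * exp (a\<^sup>2 / (2 * (1 + b)))) * (\<integral>x. normal_density (- a / (1 + b)) s x \<partial>lborel)"
    by (subst integral_density) auto
  also have "s = (1 + b) powr (- 1 / 2)"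
    using assms by (simp add: s_def powr_minus_divide powr_half_sqrt)
  finally show ?thesis
    using s(1) by (simp add: s_def)
qed

text \<open>The linear form \<open>t \<bullet> X\<close> is normal with mean \<open>0\<close> and variance \<open>t \<bullet> (\<Sigma> *v t)\<close>; positive definiteness
  rules out the degenerate laws. Since the law of \<open>X\<close> is symmetric, the characteristic function is
  given by the cosine alone.\<close>

lemma gaussian_vector_cos:
  fixes X :: "'a \<Rightarrow> real ^ 'n"
  assumes "prob_space M" "gaussian_vector M X" "mean_zero M X"
    and cov: "covariance_matrix M X = \<Sigma>" and pd: "positive_definite \<Sigma>"
  shows "(\<integral>\<omega>. cos (t \<bullet> X \<omega>) \<partial>M) = exp (- (t \<bullet> (\<Sigma> *v t)) / 2)"
proof -
  interpret prob_space M by fact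
  have X [measurable]: "X \<in> borel_measurable M"
    using assms(2) by (simp add: gaussian_vector_def)
  have comp [measurable]: "(\<lambda>\<omega>. X \<omega> $ i) \<in> borel_measurable M" for i
    by (rule borel_measurable_vec_component[OF X])
  have gauss: "(\<exists>m s. s > 0 \<and> distributed M lborel (\<lambda>\<omega>. u \<bullet> X \<omega>) (\<lambda>x. ennreal (normal_density m s x)))
        \<or> (\<exists>m. AE \<omega> in M. u \<bullet> X \<omega> = m)" for u
    using assms(2) by (simp add: gaussian_vector_def)
  have mean: "expectation (\<lambda>\<omega>. X \<omega> $ i) = 0" for i
    using assms(3) by (simp add: mean_zero_def)
  have \<Sigma>: "\<Sigma> $ i $ j = expectation (\<lambda>\<omega>. X \<omega> $ i * X \<omega> $ j)" for i j
    using cov by (auto simp: covariance_matrix_def mean)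
  have int1: "integrable M (\<lambda>\<omega>. X \<omega> $ i)" and int2: "integrable M (\<lambda>\<omega>. (X \<omega> $ i)\<^sup>2)" for i
  proof -
    have "\<not> (\<exists>m. AE \<omega> in M. X \<omega> $ i = m)"
    proof
      assume "\<exists>m. AE \<omega> in M. X \<omega> $ i = m"
      then obtain m where m: "AE \<omega> in M. X \<omega> $ i = m" by blast
      have "expectation (\<lambda>\<omega>. X \<omega> $ i) = expectation (\<lambda>\<omega>. m)"
        using m by (intro integral_cong_AE) auto
      then have "m = 0" by (simp add: mean prob_space)
      then have "expectation (\<lambda>\<omega>. X \<omega> $ i * X \<omega> $ i) = expectation (\<lambda>\<omega>. 0)"
        using m by (intro integral_cong_AE) auto
      then show False
        using positive_definite_diag_pos[OF pd, of i] by (simp add: \<Sigma>)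
    qed
    then obtain m s where s: "s > 0"
      and D: "distributed M lborel (\<lambda>\<omega>. X \<omega> $ i) (\<lambda>x. ennreal (normal_density m s x))"
      using gauss[of "axis i 1"] by (auto simp: inner_axis')
    show 1: "integrable M (\<lambda>\<omega>. X \<omega> $ i)"
      using distributed_integrable[OF D, of "\<lambda>x. x"] integrable_normal_moment_nz_1[OF s, of m] by simp
    have 2: "integrable M (\<lambda>\<omega>. (X \<omega> $ i - m)\<^sup>2)"
      using distributed_integrable[OF D, of "\<lambda>x. (x - m)\<^sup>2"] integrable_normal_moment[OF s, of m 2] by simp
    have "integrable M (\<lambda>\<omega>. (X \<omega> $ i - m)\<^sup>2 + 2 * m * (X \<omega> $ i) - m\<^sup>2)"
      using 1 2 by auto
    then show "integrable M (\<lambda>\<omega>. (X \<omega> $ i)\<^sup>2)"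
      by (simp add: power2_diff mult_ac)
  qed
  have int_prod: "integrable M (\<lambda>\<omega>. X \<omega> $ i * X \<omega> $ j)" for i j
  proof (rule Bochner_Integration.integrable_bound)
    show "integrable M (\<lambda>\<omega>. (X \<omega> $ i)\<^sup>2 + (X \<omega> $ j)\<^sup>2)" using int2 by auto
    have "\<bar>x * y\<bar> \<le> \<bar>x\<^sup>2 + y\<^sup>2\<bar>" for x y :: real
    proof -
      have "2 * (\<bar>x\<bar> * \<bar>y\<bar>) \<le> x\<^sup>2 + y\<^sup>2"
        using sum_squares_bound[of "\<bar>x\<bar>" "\<bar>y\<bar>"] by simp
      then have "\<bar>x\<bar> * \<bar>y\<bar> \<le> x\<^sup>2 + y\<^sup>2"
        using mult_nonneg_nonneg[OF abs_ge_zero[of x] abs_ge_zero[of y]] by linarith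
      then show ?thesis by (simp add: abs_mult)
    qed
    then show "AE \<omega> in M. norm (X \<omega> $ i * X \<omega> $ j) \<le> norm ((X \<omega> $ i)\<^sup>2 + (X \<omega> $ j)\<^sup>2)" by simp
  qed measurable
  have lin_mean: "expectation (\<lambda>\<omega>. t \<bullet> X \<omega>) = 0"
    by (simp add: inner_vec_def int1 mean)
  have "(t \<bullet> X \<omega>)\<^sup>2 = (\<Sum>i\<in>UNIV. \<Sum>j\<in>UNIV. t $ i * t $ j * (X \<omega> $ i * X \<omega> $ j))" for \<omega>
    by (simp add: power2_eq_square inner_vec_def sum_product mult_ac)
  then have var: "expectation (\<lambda>\<omega>. (t \<bullet> X \<omega>)\<^sup>2) = t \<bullet> (\<Sigma> *v t)"
    by (simp add: int_prod \<Sigma>[symmetric] inner_vec_def matrix_vector_mult_def sum_distrib_left mult_ac)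
  show ?thesis
  proof (cases "t = 0")
    case True
    then show ?thesis by (simp add: prob_space)
  next
    case False
    then have pos: "0 < t \<bullet> (\<Sigma> *v t)"
      using pd by (simp add: positive_definite_def)
    have "\<not> (\<exists>m. AE \<omega> in M. t \<bullet> X \<omega> = m)"
    proof
      assume "\<exists>m. AE \<omega> in M. t \<bullet> X \<omega> = m"
      then obtain m where m: "AE \<omega> in M. t \<bullet> X \<omega> = m" by blast
      have "expectation (\<lambda>\<omega>. t \<bullet> X \<omega>) = expectation (\<lambda>\<omega>. m)"
        using m by (intro integral_cong_AE) auto
      then have "m = 0" by (simp add: lin_mean prob_space)
      then have "expectation (\<lambda>\<omega>. (t \<bullet> X \<omega>)\<^sup>2) = expectation (\<lambda>\<omega>. 0)"
        using m by (intro integral_cong_AE) auto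
      then show False
        using pos by (simp add: var)
    qed
    then obtain m s where s: "s > 0"
      and D: "distributed M lborel (\<lambda>\<omega>. t \<bullet> X \<omega>) (\<lambda>x. ennreal (normal_density m s x))"
      using gauss[of t] by blast
    have m: "m = 0"
      using normal_distributed_expectation[OF s D] lin_mean by simp
    have s2: "s\<^sup>2 = t \<bullet> (\<Sigma> *v t)"
      using normal_distributed_variance[OF s D] lin_mean var by simp
    have "distributed M lborel (\<lambda>\<omega>. (t \<bullet> X \<omega> - m) / s) std_normal_density"
      using D unfolding normal_standard_normal_convert[OF s] .
    then have D': "distributed M lborel (\<lambda>\<omega>. t \<bullet> X \<omega> / s) std_normal_density"
      by (simp add: m)
    have "(\<integral>\<omega>. cos (t \<bullet> X \<omega>) \<partial>M) = (\<integral>\<omega>. cos (s * (t \<bullet> X \<omega> / s)) \<partial>M)"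
      using s by simp
    also have "\<dots> = (\<integral>x. std_normal_density x * cos (s * x) \<partial>lborel)"
      using distributed_integral[OF D', of "\<lambda>x. cos (s * x)"] by simp
    also have "\<dots> = (\<integral>x. cos (s * x) \<partial>std_normal_distribution)"
      by (subst integral_density) auto
    finally show ?thesis
      by (simp add: std_normal_integral_cos s2)
  qed
qed


lemma symmetric_right_inverse:
  fixes A B :: "real ^ 'n ^ 'n"
  assumes "transpose A = A" "A ** B = mat 1"
  shows "transpose B = B"
proof -
  have "transpose B ** A = mat 1"
    using assms by (metis matrix_transpose_mul transpose_mat)
  then show ?thesis
    using assms(2) by (metis matrix_mul_assoc matrix_mul_lid matrix_mul_rid)
qed

definition add_diag :: "real ^ 'n ^ 'n \<Rightarrow> ('n \<Rightarrow> real) \<Rightarrow> real ^ 'n ^ 'n" where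
  "add_diag A l = (\<chi> i j. A $ i $ j + (if i = j then l i else 0))"

lemma positive_definite_add_diag:
  assumes "positive_definite A" "\<And>i. 0 \<le> l i"
  shows "positive_definite (add_diag A l)"
  unfolding positive_definite_def
proof (intro conjI allI impI)
  show "transpose (add_diag A l) = add_diag A l"
    using positive_definite_sym[OF assms(1)] by (auto simp: vec_eq_iff transpose_def add_diag_def)
  fix x :: "real ^ 'a"
  assume x: "x \<noteq> 0"
  have "(add_diag A l *v x) $ i = (A *v x) $ i + l i * x $ i" for i
    by (simp add: matrix_vector_mult_def add_diag_def distrib_right sum.distrib if_distrib[of "\<lambda>y. y * _"] cong: if_cong)
  then have "x \<bullet> (add_diag A l *v x) = x \<bullet> (A *v x) + (\<Sum>i\<in>UNIV. l i * (x $ i)\<^sup>2)"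
    by (simp add: inner_vec_def distrib_left sum.distrib power2_eq_square mult_ac)
  moreover have "0 \<le> (\<Sum>i\<in>UNIV. l i * (x $ i)\<^sup>2)"
    by (intro sum_nonneg) (simp add: assms(2))
  ultimately show "0 < x \<bullet> (add_diag A l *v x)"
    using assms(1) x by (simp add: positive_definite_def add_pos_nonneg)
qed

text \<open>The Sherman--Morrison formula and the matrix determinant lemma for a change of one diagonal
  entry. The new inverse is described by its quadratic form, which is what enters a characteristic
  function.\<close>

lemma add_diag_single_inverse:
  fixes A B :: "real ^ 'n ^ 'n" and k :: 'n and l :: real
  assumes A: "positive_definite A" and AB: "A ** B = mat 1" and "0 \<le> l"
  defines "\<sigma> \<equiv> B $ k $ k" and "u \<equiv> B *v axis k 1" and "A' \<equiv> add_diag A (\<lambda>i. if i = k then l else 0)"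
  shows "0 \<le> \<sigma>" and "det A' = det A * (1 + l * \<sigma>)"
    and "\<exists>B'. A' ** B' = mat 1 \<and> (\<forall>t. t \<bullet> (B' *v t) = t \<bullet> (B *v t) - l * (u \<bullet> t)\<^sup>2 / (1 + l * \<sigma>))"
proof -
  have symB: "transpose B = B"
    using A AB symmetric_right_inverse[of A B] by (simp add: positive_definite_def)
  have Au: "A *v u = axis k 1"
    by (simp add: u_def matrix_vector_mul_assoc AB)
  have uk: "u $ k = \<sigma>"
    by (simp add: u_def \<sigma>_def matrix_vector_mult_basis column_def)
  have "u \<noteq> 0"
  proof
    assume "u = 0"
    have "axis k (1 :: real) = A *v 0" using Au unfolding \<open>u = 0\<close> by (rule sym)
    then show False by (simp add: axis_eq_0_iff)
  qed
  then have "0 < u \<bullet> (A *v u)" using A by (simp add: positive_definite_def)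
  then show \<sigma>: "0 \<le> \<sigma>" by (simp add: Au inner_axis uk)
  have A'v: "A' *v x = A *v x + (l * x $ k) *\<^sub>R axis k 1" for x
    by (simp add: vec_eq_iff A'_def add_diag_def matrix_vector_mult_def distrib_right sum.distrib axis_def
        if_distrib[of "\<lambda>y. y * _"] cong: if_cong)
  \<comment> \<open>only the \<open>k\<close>-th column changes, and the new one is \<open>A\<close> applied to a vector\<close>
  have "det A' = det (\<chi> i j. if j = k then (A *v (axis k 1 + l *\<^sub>R u)) $ i else A $ i $ j)"
  proof -
    have "A *v (axis k 1 + l *\<^sub>R u) = column k A + l *\<^sub>R axis k 1"
      by (simp add: matrix_vector_right_distrib matrix_vector_mult_basis matrix_vector_mult_scaleR Au)
    then show ?thesis
      by (intro arg_cong[of _ _ det]) (auto simp: vec_eq_iff A'_def add_diag_def column_def axis_def)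
  qed
  then show "det A' = det A * (1 + l * \<sigma>)"
    unfolding cramer_lemma by (simp add: uk mult.commute)
  have Bt: "(B *v t) $ k = u \<bullet> t" for t
  proof -
    have "(B *v t) $ k = axis k 1 \<bullet> (B *v t)" by (simp add: inner_axis')
    also have "\<dots> = (axis k 1 v* B) \<bullet> t" by (simp only: dot_lmul_matrix)
    also have "axis k 1 v* B = transpose B *v axis k 1" by (simp only: transpose_matrix_vector)
    finally show ?thesis by (simp only: symB u_def)
  qed
  define B' where "B' = (\<chi> i j. B $ i $ j - l / (1 + l * \<sigma>) * u $ i * u $ j)"
  have B'v: "B' *v t = B *v t - (l * (u \<bullet> t) / (1 + l * \<sigma>)) *\<^sub>R u" for t
  proof -
    define m where "m = l / (1 + l * \<sigma>)"
    have "(\<Sum>j\<in>UNIV. (B $ i $ j - m * u $ i * u $ j) * t $ j)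
        = (\<Sum>j\<in>UNIV. B $ i $ j * t $ j) - m * (\<Sum>j\<in>UNIV. u $ j * t $ j) * u $ i" for i
      unfolding left_diff_distrib sum_subtractf sum_distrib_left sum_distrib_right by (simp add: mult_ac)
    then show ?thesis
      by (simp add: vec_eq_iff B'_def matrix_vector_mult_def inner_vec_def flip: m_def)
         (simp add: m_def)
  qed
  have "A' *v (B' *v t) = t" for t
  proof -
    define \<kappa> where "\<kappa> = l * (u \<bullet> t) / (1 + l * \<sigma>)"
    have pos: "1 + l * \<sigma> > 0" using \<sigma> \<open>0 \<le> l\<close> by (simp add: add_pos_nonneg)
    have \<kappa>: "\<kappa> * (1 + l * \<sigma>) = l * (u \<bullet> t)"
      using pos by (simp add: \<kappa>_def)
    have "A' *v (B' *v t) = A *v (B *v t) - \<kappa> *\<^sub>R axis k 1 + (l * (u \<bullet> t - \<kappa> * \<sigma>)) *\<^sub>R axis k 1"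
      by (simp add: A'v B'v \<kappa>_def[symmetric] matrix_vector_mult_diff_distrib matrix_vector_mult_scaleR Au Bt uk)
         (simp add: algebra_simps)
    also have "\<dots> = t + (l * (u \<bullet> t) - \<kappa> * (1 + l * \<sigma>)) *\<^sub>R axis k 1"
      by (simp add: matrix_vector_mul_assoc AB vec_eq_iff algebra_simps)
    finally show ?thesis by (simp add: \<kappa>)
  qed
  then have "A' ** B' = mat 1"
    by (simp add: matrix_eq flip: matrix_vector_mul_assoc)
  moreover have "t \<bullet> (B' *v t) = t \<bullet> (B *v t) - l * (u \<bullet> t)\<^sup>2 / (1 + l * \<sigma>)" for t
    by (simp add: B'v inner_diff_right inner_commute[of t u] power2_eq_square)
  ultimately show "\<exists>B'. A' ** B' = mat 1 \<and> (\<forall>t. t \<bullet> (B' *v t) = t \<bullet> (B *v t) - l * (u \<bullet> t)\<^sup>2 / (1 + l * \<sigma>))"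
    by blast
qed

text \<open>Writing \<open>exp (- l * x\<^sup>2 / 2)\<close> as the expectation of \<open>cos (sqrt l * x * \<xi>)\<close> for an independent
  standard normal variable \<open>\<xi>\<close> turns a Gaussian weight into a random shift of the argument \<open>t\<close>.
  By Fubini a one-dimensional Gaussian integral over \<open>\<xi>\<close> is left, which produces both the factor and
  the correction of the quadratic form.\<close>

lemma gaussian_weight_step:
  fixes X :: "'a \<Rightarrow> real ^ 'n" and w :: "'a \<Rightarrow> real"
  assumes "prob_space M" and X [measurable]: "X \<in> borel_measurable M"
    and w [measurable]: "w \<in> borel_measurable M" and w01: "\<And>\<omega>. 0 \<le> w \<omega>" "\<And>\<omega>. w \<omega> \<le> 1"
    and symB: "transpose B = B" and B: "0 \<le> B $ k $ k" and "0 \<le> l"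
    and char: "\<And>t. (\<integral>\<omega>. w \<omega> * cos (t \<bullet> X \<omega>) \<partial>M) = c * exp (- (t \<bullet> (B *v t)) / 2)"
  shows "(\<integral>\<omega>. w \<omega> * exp (- (l * (X \<omega> $ k)\<^sup>2) / 2) * cos (t \<bullet> X \<omega>) \<partial>M)
       = c * (1 + l * B $ k $ k) powr (- 1 / 2) *
         exp (- (t \<bullet> (B *v t) - l * ((B *v axis k 1) \<bullet> t)\<^sup>2 / (1 + l * B $ k $ k)) / 2)"
proof -
  interpret prob_space M by fact
  interpret N: prob_space std_normal_distribution by (rule prob_space_std_normal)
  interpret pair_prob_space M std_normal_distribution ..
  define r where "r = sqrt l"
  have r2: "r\<^sup>2 = l" using \<open>0 \<le> l\<close> by (simp add: r_def)
  define e where "e = (axis k 1 :: real ^ 'n)"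
  define u where "u = B *v e"
  have comp [measurable]: "(\<lambda>\<omega>. X \<omega> $ k) \<in> borel_measurable M"
    by (rule borel_measurable_vec_component[OF X])
  have ue: "u \<bullet> e = B $ k $ k"
    by (simp add: u_def e_def inner_axis matrix_vector_mult_basis column_def)
  have eB: "e \<bullet> (B *v t) = u \<bullet> t" for t
    unfolding dot_lmul_matrix[symmetric] transpose_matrix_vector[symmetric] symB u_def ..
  have quad: "(t + (r * x) *\<^sub>R e) \<bullet> (B *v (t + (r * x) *\<^sub>R e))
      = t \<bullet> (B *v t) + 2 * (r * (u \<bullet> t)) * x + l * B $ k $ k * x\<^sup>2" for x
  proof -
    have "B *v (t + (r * x) *\<^sub>R e) = B *v t + (r * x) *\<^sub>R u"
      by (simp add: matrix_vector_right_distrib matrix_vector_mult_scaleR u_def)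
    then have "(t + (r * x) *\<^sub>R e) \<bullet> (B *v (t + (r * x) *\<^sub>R e))
        = t \<bullet> (B *v t) + (r * x) * (t \<bullet> u) + (r * x) * (e \<bullet> (B *v t)) + (r * x) * ((r * x) * (e \<bullet> u))"
      by (simp add: inner_add_left inner_add_right distrib_left)
    also have "\<dots> = t \<bullet> (B *v t) + 2 * (r * (u \<bullet> t)) * x + r\<^sup>2 * B $ k $ k * x\<^sup>2"
      unfolding eB inner_commute[of t u] inner_commute[of e u] ue by (simp add: power2_eq_square)
    finally show ?thesis by (simp only: r2)
  qed
  have "(\<integral>\<omega>. w \<omega> * exp (- (l * (X \<omega> $ k)\<^sup>2) / 2) * cos (t \<bullet> X \<omega>) \<partial>M)
      = (\<integral>\<omega>. (\<integral>x. w \<omega> * cos ((t + (r * x) *\<^sub>R e) \<bullet> X \<omega>) \<partial>std_normal_distribution) \<partial>M)"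
  proof (rule Bochner_Integration.integral_cong[OF refl])
    fix \<omega>
    have inner: "(\<integral>x. w \<omega> * cos ((t + (r * x) *\<^sub>R e) \<bullet> X \<omega>) \<partial>std_normal_distribution)
        = w \<omega> * (\<integral>x. cos (t \<bullet> X \<omega> + (r * X \<omega> $ k) * x) \<partial>std_normal_distribution)"
      by (simp add: inner_add_left e_def inner_axis' mult_ac)
    show "w \<omega> * exp (- (l * (X \<omega> $ k)\<^sup>2) / 2) * cos (t \<bullet> X \<omega>)
        = (\<integral>x. w \<omega> * cos ((t + (r * x) *\<^sub>R e) \<bullet> X \<omega>) \<partial>std_normal_distribution)"
      unfolding inner std_normal_integral_cos_shift by (simp add: power_mult_distrib r2)
  qed
  also have "\<dots> = (\<integral>x. (\<integral>\<omega>. w \<omega> * cos ((t + (r * x) *\<^sub>R e) \<bullet> X \<omega>) \<partial>M) \<partial>std_normal_distribution)"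
  proof (rule Fubini_integral[symmetric])
    show "integrable (M \<Otimes>\<^sub>M std_normal_distribution) (\<lambda>(\<omega>, x). w \<omega> * cos ((t + (r * x) *\<^sub>R e) \<bullet> X \<omega>))"
    proof (rule integrable_const_bound[where B=1])
      have "\<bar>w \<omega> * cos z\<bar> \<le> 1" for \<omega> z
        using mult_mono[of "\<bar>w \<omega>\<bar>" 1 "\<bar>cos z\<bar>" 1] w01[of \<omega>] by (simp add: abs_mult)
      then show "AE z in M \<Otimes>\<^sub>M std_normal_distribution.
          norm (case z of (\<omega>, x) \<Rightarrow> w \<omega> * cos ((t + (r * x) *\<^sub>R e) \<bullet> X \<omega>)) \<le> 1"
        by (simp add: case_prod_beta)
    qed measurable
  qed
  also have "\<dots> = (\<integral>x. (c * exp (- (t \<bullet> (B *v t)) / 2)) *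
      exp (- ((r * (u \<bullet> t)) * x) - (l * B $ k $ k) * x\<^sup>2 / 2) \<partial>std_normal_distribution)"
  proof (rule Bochner_Integration.integral_cong[OF refl])
    fix x
    have "- (t \<bullet> (B *v t) + 2 * (r * (u \<bullet> t)) * x + l * B $ k $ k * x\<^sup>2) / 2
        = - (t \<bullet> (B *v t)) / 2 + (- ((r * (u \<bullet> t)) * x) - (l * B $ k $ k) * x\<^sup>2 / 2)"
      by (simp add: add_divide_distrib diff_divide_distrib)
    then show "(\<integral>\<omega>. w \<omega> * cos ((t + (r * x) *\<^sub>R e) \<bullet> X \<omega>) \<partial>M) = (c * exp (- (t \<bullet> (B *v t)) / 2)) *
        exp (- ((r * (u \<bullet> t)) * x) - (l * B $ k $ k) * x\<^sup>2 / 2)"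
      unfolding char quad by (simp only: exp_add mult.assoc)
  qed
  also have "\<dots> = (c * exp (- (t \<bullet> (B *v t)) / 2)) * ((1 + l * B $ k $ k) powr (- 1 / 2) *
      exp ((r * (u \<bullet> t))\<^sup>2 / (2 * (1 + l * B $ k $ k))))"
    using B \<open>0 \<le> l\<close> by (subst integral_mult_right_zero) (simp add: std_normal_integral_exp_quadratic)
  also have "\<dots> = c * (1 + l * B $ k $ k) powr (- 1 / 2) *
      (exp (- (t \<bullet> (B *v t)) / 2) * exp ((r * (u \<bullet> t))\<^sup>2 / (2 * (1 + l * B $ k $ k))))"
    by (simp only: mult_ac)
  also have "exp (- (t \<bullet> (B *v t)) / 2) * exp ((r * (u \<bullet> t))\<^sup>2 / (2 * (1 + l * B $ k $ k)))
      = exp (- (t \<bullet> (B *v t) - l * (u \<bullet> t)\<^sup>2 / (1 + l * B $ k $ k)) / 2)"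
    unfolding exp_add[symmetric]
    by (rule arg_cong[of _ _ exp]) (simp add: power_mult_distrib r2 diff_divide_distrib)
  finally show ?thesis by (simp only: u_def e_def)
qed


text \<open>The weights are introduced one coordinate at a time. Weighting by \<open>exp (- l i * (X $ i)\<^sup>2 / 2)\<close>
  keeps the characteristic function Gaussian, adds \<open>l i\<close> to the \<open>i\<close>-th diagonal entry of the inverse
  covariance matrix and multiplies the total mass by the corresponding ratio of determinants to the
  power \<open>- 1 / 2\<close>. The claim is the case \<open>t = 0\<close>.\<close>

lemma gaussian_squares_transform:
  fixes X :: "'a \<Rightarrow> real ^ 'n" and l :: "'n \<Rightarrow> real"
  assumes "prob_space M" "gaussian_vector M X" "mean_zero M X"
    and cov: "covariance_matrix M X = \<Sigma>" and pd: "positive_definite \<Sigma>"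
    and Q: "positive_definite Q" "Q ** \<Sigma> = mat 1" "0 < det Q" and l: "\<And>i. 0 \<le> l i"
  shows "(\<integral>\<omega>. exp (- (\<Sum>i\<in>UNIV. l i * (X \<omega> $ i)\<^sup>2) / 2) \<partial>M) = (det (add_diag Q l) / det Q) powr (- 1 / 2)"
proof -
  have X [measurable]: "X \<in> borel_measurable M"
    using assms(2) by (simp add: gaussian_vector_def)
  have comp [measurable]: "(\<lambda>\<omega>. X \<omega> $ i) \<in> borel_measurable M" for i
    by (rule borel_measurable_vec_component[OF X])
  define w where "w S \<omega> = exp (- (\<Sum>i\<in>S. l i * (X \<omega> $ i)\<^sup>2) / 2)" for S \<omega>
  define A where "A S = add_diag Q (\<lambda>i. if i \<in> S then l i else 0)" for S
  have main: "\<exists>B. A S ** B = mat 1 \<and> 0 < det (A S) \<and>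
      (\<forall>t. (\<integral>\<omega>. w S \<omega> * cos (t \<bullet> X \<omega>) \<partial>M) = (det (A S) / det Q) powr (- 1 / 2) * exp (- (t \<bullet> (B *v t)) / 2))"
    if "finite S" for S
    using that
  proof (induction S rule: finite_induct)
    case empty
    have "A {} = Q" by (simp add: A_def add_diag_def vec_eq_iff)
    then show ?case
      using Q gaussian_vector_cos[OF assms(1-5)] by (auto simp: w_def intro!: exI[of _ \<Sigma>])
  next
    case (insert k S)
    then obtain B where AB: "A S ** B = mat 1" and det: "0 < det (A S)"
      and char: "\<And>t. (\<integral>\<omega>. w S \<omega> * cos (t \<bullet> X \<omega>) \<partial>M) = (det (A S) / det Q) powr (- 1 / 2) * exp (- (t \<bullet> (B *v t)) / 2)"
      by blast
    have pdA: "positive_definite (A S)"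
      unfolding A_def using Q(1) l by (intro positive_definite_add_diag) auto
    have A': "A (insert k S) = add_diag (A S) (\<lambda>i. if i = k then l k else 0)"
      using insert.hyps by (auto simp: A_def add_diag_def vec_eq_iff)
    note step = add_diag_single_inverse[OF pdA AB l[of k], of k, folded A']
    obtain B' where B': "A (insert k S) ** B' = mat 1"
      and quad: "\<And>t. t \<bullet> (B' *v t) = t \<bullet> (B *v t) - l k * ((B *v axis k 1) \<bullet> t)\<^sup>2 / (1 + l k * B $ k $ k)"
      using step(3) by blast
    have pos: "0 < 1 + l k * B $ k $ k" using step(1) l[of k] by (simp add: add_pos_nonneg)
    have w': "w (insert k S) \<omega> = w S \<omega> * exp (- (l k * (X \<omega> $ k)\<^sup>2) / 2)" for \<omega>
      using insert.hyps by (simp add: w_def add_divide_distrib flip: exp_add)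
    have "(\<integral>\<omega>. w (insert k S) \<omega> * cos (t \<bullet> X \<omega>) \<partial>M)
        = (det (A (insert k S)) / det Q) powr (- 1 / 2) * exp (- (t \<bullet> (B' *v t)) / 2)" for t
    proof -
      have "(\<integral>\<omega>. w (insert k S) \<omega> * cos (t \<bullet> X \<omega>) \<partial>M)
          = (det (A S) / det Q) powr (- 1 / 2) * (1 + l k * B $ k $ k) powr (- 1 / 2) * exp (- (t \<bullet> (B' *v t)) / 2)"
        unfolding w' quad
      proof (rule gaussian_weight_step[OF assms(1) X _ _ _ _ step(1) l char])
        show "w S \<in> borel_measurable M" unfolding w_def by measurable
        show "0 \<le> w S \<omega>" "w S \<omega> \<le> 1" for \<omega>
          using l by (auto simp: w_def intro!: sum_nonneg)
        show "transpose B = B"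
          using pdA AB symmetric_right_inverse[of "A S" B] by (simp add: positive_definite_def)
      qed
      also have "(det (A S) / det Q) powr (- 1 / 2) * (1 + l k * B $ k $ k) powr (- 1 / 2)
          = (det (A (insert k S)) / det Q) powr (- 1 / 2)"
        using det Q(3) pos by (simp add: step(2) powr_mult[symmetric])
      finally show ?thesis .
    qed
    moreover have "0 < det (A (insert k S))"
      using det pos by (simp add: step(2))
    ultimately show ?case using B' by blast
  qed
  obtain B where "\<forall>t. (\<integral>\<omega>. w UNIV \<omega> * cos (t \<bullet> X \<omega>) \<partial>M)
      = (det (A UNIV) / det Q) powr (- 1 / 2) * exp (- (t \<bullet> (B *v t)) / 2)"
    using main[of UNIV] by auto
  from this[rule_format, of 0] show ?thesis by (simp add: w_def A_def)
qed

section \<open>Uniqueness of Laplace transforms\<close>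

text \<open>The indicator of a closed set is the limit of continuous functions that decay with the distance
  from the set, and the closed sets generate the Borel sets.\<close>

lemma prob_measure_eqI_continuous:
  fixes \<mu> \<nu> :: "'a::euclidean_space measure"
  assumes "prob_space \<mu>" "prob_space \<nu>" and [simp]: "sets \<mu> = sets borel" "sets \<nu> = sets borel"
    and eq: "\<And>f :: 'a \<Rightarrow> real. \<lbrakk>continuous_on UNIV f; \<And>x. 0 \<le> f x \<and> f x \<le> 1\<rbrakk>
               \<Longrightarrow> integral\<^sup>L \<mu> f = integral\<^sup>L \<nu> f"
  shows "\<mu> = \<nu>"
proof -
  interpret \<mu>: prob_space \<mu> by fact
  interpret \<nu>: prob_space \<nu> by fact
  have [measurable_cong]: "sets \<mu> = sets borel" "sets \<nu> = sets borel" by simp_all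
  have [simp]: "space \<mu> = UNIV" "space \<nu> = UNIV"
    by (simp_all add: sets_eq_imp_space_eq[of _ borel])
  have closed_eq: "emeasure \<mu> C = emeasure \<nu> C" if C: "closed C" for C
  proof (cases "C = {}")
    case False
    have [measurable]: "C \<in> sets borel" using C by (simp add: borel_closed)
    define f where "f n x = max 0 (1 - real n * infdist x C)" for n x
    have f01: "0 \<le> f n x \<and> f n x \<le> 1" for n x
      by (auto simp: f_def infdist_nonneg)
    have cont: "continuous_on UNIV (f n)" for n
      unfolding f_def by (intro continuous_intros)
    have meas: "f n \<in> borel_measurable borel" for n
      using cont by (rule borel_measurable_continuous_onI)
    have lim: "(\<lambda>n. f n x) \<longlonglongrightarrow> indicator C x" for x
    proof (cases "x \<in> C")
      case True
      then show ?thesis by (simp add: f_def)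
    next
      case nin: False
      then have "infdist x C > 0"
        using C False by (simp add: infdist_pos_not_in_closed)
      then have "eventually (\<lambda>n. real n * infdist x C > 1) sequentially"
        by real_asymp
      then have "eventually (\<lambda>n. f n x = 0) sequentially"
        by eventually_elim (simp add: f_def)
      then show ?thesis
        using nin by (simp add: tendsto_eventually)
    qed
    have "(\<lambda>n. integral\<^sup>L \<mu> (f n)) \<longlonglongrightarrow> integral\<^sup>L \<mu> (indicator C)"
      by (rule integral_dominated_convergence[where w="\<lambda>_. 1"])
         (use f01 meas lim in auto)
    moreover have "(\<lambda>n. integral\<^sup>L \<nu> (f n)) \<longlonglongrightarrow> integral\<^sup>L \<nu> (indicator C)"
      by (rule integral_dominated_convergence[where w="\<lambda>_. 1"])
         (use f01 meas lim in auto)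
    moreover have "integral\<^sup>L \<mu> (f n) = integral\<^sup>L \<nu> (f n)" for n
      using cont f01 by (rule eq)
    ultimately have "integral\<^sup>L \<mu> (indicator C) = (integral\<^sup>L \<nu> (indicator C) :: real)"
      using LIMSEQ_unique by fastforce
    then have "measure \<mu> C = measure \<nu> C"
      using C by (simp add: borel_closed)
    then show ?thesis
      by (simp add: \<mu>.emeasure_eq_measure \<nu>.emeasure_eq_measure)
  qed simp
  show ?thesis
  proof (rule measure_eqI_generator_eq[where E="Collect closed" and \<Omega>=UNIV and A="\<lambda>_. UNIV"])
    show "Int_stable (Collect closed)"
      by (auto simp: Int_stable_def)
    show "sets \<mu> = sigma_sets UNIV (Collect closed)" "sets \<nu> = sigma_sets UNIV (Collect closed)"
      by (simp_all add: borel_eq_closed)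
  qed (use closed_eq in auto)
qed

text \<open>By the Stone--Weierstrass theorem polynomials are uniformly dense on the cube, so the moments
  determine all integrals of continuous functions.\<close>

lemma prob_measure_on_cube_eqI:
  fixes \<mu> \<nu> :: "(real ^ 'n) measure"
  assumes "prob_space \<mu>" "prob_space \<nu>" and [simp]: "sets \<mu> = sets borel" "sets \<nu> = sets borel"
    and cube: "AE x in \<mu>. x \<in> cbox 0 1" "AE x in \<nu>. x \<in> cbox 0 1"
    and moments: "\<And>m :: 'n \<Rightarrow> nat. (\<integral>x. (\<Prod>i\<in>UNIV. (x $ i) ^ m i) \<partial>\<mu>) = (\<integral>x. (\<Prod>i\<in>UNIV. (x $ i) ^ m i) \<partial>\<nu>)"
  shows "\<mu> = \<nu>"
proof (rule prob_measure_eqI_continuous)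
  interpret \<mu>: prob_space \<mu> by fact
  interpret \<nu>: prob_space \<nu> by fact
  have [measurable_cong]: "sets \<mu> = sets borel" "sets \<nu> = sets borel" by simp_all
  have int: "integrable \<kappa> f" if k: "prob_space \<kappa>" "sets \<kappa> = sets borel" "AE x in \<kappa>. x \<in> cbox 0 1"
    and f: "continuous_on UNIV f" for \<kappa> and f :: "real ^ 'n \<Rightarrow> real"
  proof -
    interpret \<kappa>: prob_space \<kappa> by fact
    have "bounded (f ` cbox 0 1)"
      using f by (intro compact_imp_bounded compact_continuous_image) (auto intro: continuous_on_subset)
    then obtain B where B: "\<And>x. x \<in> cbox 0 1 \<Longrightarrow> norm (f x) \<le> B"
      by (auto simp: bounded_iff)
    show ?thesis
    proof (rule \<kappa>.integrable_const_bound[where B=B])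
      show "AE x in \<kappa>. norm (f x) \<le> B" using k(3) by eventually_elim (rule B)
      show "f \<in> borel_measurable \<kappa>"
        by (subst measurable_cong_sets[OF k(2) refl]) (rule borel_measurable_continuous_onI[OF f])
    qed
  qed
  note int\<mu> = int[OF assms(1,3,5)] and int\<nu> = int[OF assms(2,4,6)]
  define mono where "mono m x = (\<Prod>i\<in>UNIV. (x $ i) ^ m i)" for m :: "'n \<Rightarrow> nat" and x :: "real ^ 'n"
  have cmono: "continuous_on UNIV (mono m)" for m
    unfolding mono_def by (intro continuous_intros)
  \<comment> \<open>multiplication by a coordinate only shifts the exponents, so \<open>H\<close> is stable under it\<close>
  define H where "H = {h. continuous_on UNIV h \<and> (\<forall>m. (\<integral>x. h x * mono m x \<partial>\<mu>) = (\<integral>x. h x * mono m x \<partial>\<nu>))}"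
  have H_add: "(\<lambda>x. g x + h x) \<in> H" if "g \<in> H" "h \<in> H" for g h
  proof -
    have cont: "continuous_on UNIV g" "continuous_on UNIV h"
      and eq: "\<And>m. (\<integral>x. g x * mono m x \<partial>\<mu>) = (\<integral>x. g x * mono m x \<partial>\<nu>)"
        "\<And>m. (\<integral>x. h x * mono m x \<partial>\<mu>) = (\<integral>x. h x * mono m x \<partial>\<nu>)"
      using that by (auto simp: H_def)
    have c: "continuous_on UNIV (\<lambda>x. g x * mono m x)" "continuous_on UNIV (\<lambda>x. h x * mono m x)" for m
      by (intro continuous_intros cont cmono)+
    have "(\<integral>x. (g x + h x) * mono m x \<partial>\<mu>) = (\<integral>x. (g x + h x) * mono m x \<partial>\<nu>)" for m
      using Bochner_Integration.integral_add[OF int\<mu>[OF c(1)] int\<mu>[OF c(2)], of m m]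
        Bochner_Integration.integral_add[OF int\<nu>[OF c(1)] int\<nu>[OF c(2)], of m m] eq[of m]
      by (simp add: distrib_right)
    then show ?thesis
      unfolding H_def using cont by (auto intro!: continuous_intros)
  qed
  have H_scale: "(\<lambda>x. c * h x) \<in> H" if "h \<in> H" for h c
    using that unfolding H_def by (auto simp: mult.assoc intro!: continuous_intros)
  have H_coord: "(\<lambda>x. x $ i * h x) \<in> H" if h: "h \<in> H" for h i
  proof -
    have shift: "x $ i * h x * mono m x = h x * mono (m(i := Suc (m i))) x" for m x
    proof -
      have "mono (m(i := Suc (m i))) x = x $ i * mono m x"
        unfolding mono_def
        using prod.remove[of UNIV i "\<lambda>j. (x $ j) ^ (m(i := Suc (m i))) j"]
          prod.remove[of UNIV i "\<lambda>j. (x $ j) ^ m j"]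
        by (simp add: mult.assoc)
      then show ?thesis by (simp add: mult_ac)
    qed
    have "continuous_on UNIV (\<lambda>x. x $ i * h x)"
      using h unfolding H_def by (auto intro!: continuous_intros)
    then show ?thesis
      using h unfolding H_def by (simp only: mem_Collect_eq shift simp_thms)
  qed
  have H_sum: "(\<lambda>x. \<Sum>i\<in>I. g i x) \<in> H" if "finite I" "\<And>i. i \<in> I \<Longrightarrow> g i \<in> H" for I :: "'n set" and g
    using that
  proof (induction I rule: finite_induct)
    case empty
    then show ?case by (simp add: H_def)
  next
    case (insert i I)
    then have "(\<lambda>x. g i x + (\<Sum>i\<in>I. g i x)) \<in> H"
      by (intro H_add) auto
    then show ?case using insert.hyps by simp
  qed
  have H_poly: "\<forall>h\<in>H. (\<lambda>x. g x * h x) \<in> H" if "real_polynomial_function g" for g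
    using that
  proof (induction rule: real_polynomial_function.induct)
    case (linear f)
    have f_eq: "f x = (\<Sum>i\<in>UNIV. f (axis i 1) * x $ i)" for x
    proof -
      interpret f: bounded_linear f by fact
      have "x = (\<Sum>i\<in>UNIV. (x $ i) *\<^sub>R axis i 1)"
        by (simp add: vec_eq_iff axis_def if_distrib cong: if_cong)
      then have "f x = f (\<Sum>i\<in>UNIV. (x $ i) *\<^sub>R axis i 1)" by (rule arg_cong)
      also have "\<dots> = (\<Sum>i\<in>UNIV. f (axis i 1) * x $ i)" by (simp add: f.sum f.scaleR mult.commute)
      finally show ?thesis .
    qed
    have "f x * h x = (\<Sum>i\<in>UNIV. f (axis i 1) * (x $ i * h x))" for h :: "real ^ 'n \<Rightarrow> real" and x
      by (subst f_eq) (simp add: sum_distrib_right mult.assoc)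
    moreover have "(\<lambda>x. \<Sum>i\<in>UNIV. f (axis i 1) * (x $ i * h x)) \<in> H" if "h \<in> H" for h
      by (intro H_sum H_scale H_coord that) simp
    ultimately show ?case by presburger
  next
    case (const c)
    then show ?case by (simp add: H_scale)
  next
    case (add f g)
    then have "(\<lambda>x. f x * h x + g x * h x) \<in> H" if "h \<in> H" for h
      using that by (intro H_add) auto
    then show ?case by (simp add: distrib_right)
  next
    case (mult f g)
    then show ?case by (auto simp: mult.assoc)
  qed
  have H_one: "(\<lambda>x. 1) \<in> H"
    using moments by (simp add: H_def mono_def)
  have poly: "integral\<^sup>L \<mu> g = integral\<^sup>L \<nu> g" if "real_polynomial_function g" for g
  proof -
    have "g \<in> H" using H_poly[OF that] H_one by fastforce
    then have "(\<integral>x. g x * mono (\<lambda>_. 0) x \<partial>\<mu>) = (\<integral>x. g x * mono (\<lambda>_. 0) x \<partial>\<nu>)"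
      unfolding H_def by blast
    then show ?thesis by (simp add: mono_def)
  qed
  fix f :: "real ^ 'n \<Rightarrow> real"
  assume f: "continuous_on UNIV f"
  have close: "\<bar>integral\<^sup>L \<mu> f - integral\<^sup>L \<nu> f\<bar> \<le> 2 * e" if e: "e > 0" for e
  proof -
    obtain g where g: "real_polynomial_function g" "\<And>x. x \<in> cbox 0 1 \<Longrightarrow> \<bar>f x - g x\<bar> < e"
      using Stone_Weierstrass_real_polynomial_function[OF compact_cbox continuous_on_subset[OF f subset_UNIV] e]
      by blast
    have cg: "continuous_on UNIV g"
      using g(1) by (simp add: continuous_on_polymonial_function real_polynomial_function_eq)
    have near: "\<bar>integral\<^sup>L \<kappa> f - integral\<^sup>L \<kappa> g\<bar> \<le> e"
      if k: "prob_space \<kappa>" "sets \<kappa> = sets borel" "AE x in \<kappa>. x \<in> cbox 0 1" for \<kappa>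
    proof -
      interpret \<kappa>: prob_space \<kappa> by fact
      have "\<bar>integral\<^sup>L \<kappa> f - integral\<^sup>L \<kappa> g\<bar> = \<bar>\<integral>x. f x - g x \<partial>\<kappa>\<bar>"
        using int[OF k f] int[OF k cg] by simp
      also have "\<dots> \<le> (\<integral>x. \<bar>f x - g x\<bar> \<partial>\<kappa>)"
        by (rule integral_abs_bound)
      also have "\<dots> \<le> (\<integral>x. e \<partial>\<kappa>)"
      proof (rule integral_mono_AE)
        show "AE x in \<kappa>. \<bar>f x - g x\<bar> \<le> e" using k(3) by eventually_elim (rule less_imp_le[OF g(2)])
      qed (use int[OF k f] int[OF k cg] in auto)
      finally show ?thesis by (simp add: \<kappa>.prob_space)
    qed
    show ?thesis
      using near[OF assms(1,3,5)] near[OF assms(2,4,6)] poly[OF g(1)] by linarith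
  qed
  have "\<bar>integral\<^sup>L \<mu> f - integral\<^sup>L \<nu> f\<bar> \<le> 0"
  proof (rule field_le_epsilon)
    fix e :: real
    assume "e > 0"
    then show "\<bar>integral\<^sup>L \<mu> f - integral\<^sup>L \<nu> f\<bar> \<le> 0 + e"
      using close[of "e / 2"] by simp
  qed
  then show "integral\<^sup>L \<mu> f = integral\<^sup>L \<nu> f" by simp
qed (use assms in auto)

text \<open>Under \<open>x \<mapsto> (exp (- x $ i))\<close> the orthant becomes a subset of the unit cube, and the values of the Laplace
  transform at integer points become the moments.\<close>

lemma laplace_transform_unique:
  fixes \<mu> \<nu> :: "(real ^ 'n) measure"
  assumes "prob_space \<mu>" "prob_space \<nu>" and [simp]: "sets \<mu> = sets borel" "sets \<nu> = sets borel"
    and nonneg: "AE x in \<mu>. 0 \<le> x" "AE x in \<nu>. 0 \<le> x"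
    and eq: "\<And>\<theta>. 0 \<le> \<theta> \<Longrightarrow> (\<integral>x. exp (- (\<theta> \<bullet> x)) \<partial>\<mu>) = (\<integral>x. exp (- (\<theta> \<bullet> x)) \<partial>\<nu>)"
  shows "\<mu> = \<nu>"
proof -
  have [measurable_cong]: "sets \<mu> = sets borel" "sets \<nu> = sets borel" by simp_all
  define \<phi> :: "real ^ 'n \<Rightarrow> real ^ 'n" where "\<phi> x = (\<chi> i. exp (- x $ i))" for x
  define \<psi> :: "real ^ 'n \<Rightarrow> real ^ 'n" where "\<psi> y = (\<chi> i. - ln (y $ i))" for y
  have \<psi>\<phi>: "\<psi> (\<phi> x) = x" for x by (simp add: \<phi>_def \<psi>_def vec_eq_iff)
  have [measurable]: "(\<lambda>x :: real ^ 'n. x $ i) \<in> borel_measurable borel" for i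
    by (rule borel_measurable_vec_component) simp
  have vec_meas: "(\<lambda>x. \<chi> i. f i x) \<in> borel_measurable borel"
    if "\<And>i. f i \<in> borel_measurable borel" for f :: "'n \<Rightarrow> real ^ 'n \<Rightarrow> real"
    using that by (subst borel_measurable_euclidean_space) (auto simp: Basis_vec_def inner_axis)
  have [measurable]: "\<phi> \<in> borel_measurable borel" "\<psi> \<in> borel_measurable borel"
    unfolding \<phi>_def \<psi>_def by (intro vec_meas; measurable)+
  have "distr \<mu> borel \<phi> = distr \<nu> borel \<phi>"
  proof (rule prob_measure_on_cube_eqI)
    show "prob_space (distr \<mu> borel \<phi>)" "prob_space (distr \<nu> borel \<phi>)"
      using assms(1,2) by (auto intro!: prob_space.prob_space_distr)
    have "\<phi> x \<in> cbox 0 1" if "0 \<le> x" for x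
      using that by (auto simp: \<phi>_def cbox_interval less_eq_vec_def)
    then have "AE x in \<mu>. \<phi> x \<in> cbox 0 1" "AE x in \<nu>. \<phi> x \<in> cbox 0 1"
      using nonneg by (auto elim: eventually_mono)
    then show "AE x in distr \<mu> borel \<phi>. x \<in> cbox 0 1" "AE x in distr \<nu> borel \<phi>. x \<in> cbox 0 1"
      by (simp_all add: AE_distr_iff)
  next
    fix m :: "'n \<Rightarrow> nat"
    have *: "(\<Prod>i\<in>UNIV. (\<phi> x $ i) ^ m i) = exp (- ((\<chi> i. real (m i)) \<bullet> x))" for x
      by (simp add: \<phi>_def inner_vec_def exp_of_nat_mult[symmetric] exp_sum[symmetric] sum_negf)
    have "0 \<le> (\<chi> i. real (m i))" by (simp add: less_eq_vec_def)
    then show "(\<integral>x. (\<Prod>i\<in>UNIV. (x $ i) ^ m i) \<partial>distr \<mu> borel \<phi>) = (\<integral>x. (\<Prod>i\<in>UNIV. (x $ i) ^ m i) \<partial>distr \<nu> borel \<phi>)"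
      by (simp add: integral_distr * eq)
  qed simp_all
  then have "distr (distr \<mu> borel \<phi>) borel \<psi> = distr (distr \<nu> borel \<phi>) borel \<psi>" by simp
  then show ?thesis
    by (simp add: distr_distr comp_def \<psi>\<phi> distr_id2)
qed

section \<open>Infinite divisibility of sums of squares\<close>

lemma laplace_class_rescale:
  fixes f :: "real ^ 'n \<Rightarrow> real"
  assumes "laplace_class f" and "0 \<le> c"
  shows "laplace_class (\<lambda>\<theta>. f (c *\<^sub>R \<theta>))"
proof -
  obtain C \<mu> where \<mu>: "0 \<le> C" "prob_space \<mu>" "sets \<mu> = sets borel" "AE x in \<mu>. 0 \<le> x"
    "\<And>\<theta>. 0 \<le> \<theta> \<Longrightarrow> 0 \<le> f \<theta>"
    "\<And>\<theta>. 0 \<le> \<theta> \<Longrightarrow> ennreal (f \<theta>) = ennreal C * (\<integral>\<^sup>+x. ennreal (exp (- (\<theta> \<bullet> x))) \<partial>\<mu>)"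
    using assms(1) unfolding laplace_class_def by blast
  note [measurable_cong] = \<mu>(3)
  have scale_nonneg: "0 \<le> c *\<^sub>R x" if "0 \<le> x" for x :: "real ^ 'n"
    using that \<open>0 \<le> c\<close> by (simp add: less_eq_vec_def)
  show ?thesis
    unfolding laplace_class_def
  proof (intro exI conjI allI impI)
    show "0 \<le> C" by fact
    show "prob_space (distr \<mu> borel (\<lambda>x. c *\<^sub>R x))"
      by (rule prob_space.prob_space_distr[OF \<mu>(2)]) measurable
    show "sets (distr \<mu> borel (\<lambda>x. c *\<^sub>R x)) = sets borel" by simp
    show "AE x in distr \<mu> borel (\<lambda>x. c *\<^sub>R x). 0 \<le> x"
    proof (subst AE_distr_iff)
      show "AE x in \<mu>. 0 \<le> c *\<^sub>R x"
        using \<mu>(4) by eventually_elim (rule scale_nonneg)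
    qed measurable
    fix \<theta> :: "real ^ 'n"
    assume \<theta>: "0 \<le> \<theta>"
    show "0 \<le> f (c *\<^sub>R \<theta>)" by (intro \<mu>(5) scale_nonneg \<theta>)
    show "ennreal (f (c *\<^sub>R \<theta>)) = ennreal C * (\<integral>\<^sup>+x. ennreal (exp (- (\<theta> \<bullet> x))) \<partial>distr \<mu> borel (\<lambda>x. c *\<^sub>R x))"
      by (subst nn_integral_distr) (auto simp: \<mu>(6)[OF scale_nonneg[OF \<theta>]])
  qed
qed

text \<open>The \<open>n\<close>-th root takes the value \<open>1\<close> at \<open>0\<close> and is therefore the transform of a probability
  measure; \<open>n\<close> independent copies of it have a sum with the right transform.\<close>

lemma infinitely_divisible_of_laplace_roots:
  fixes Y :: "'a \<Rightarrow> real ^ 'n"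
  assumes "prob_space M" and Y [measurable]: "Y \<in> borel_measurable M" and Y_nonneg: "\<And>\<omega>. 0 \<le> Y \<omega>"
    and roots: "\<And>n. 1 \<le> n \<Longrightarrow> \<exists>f. laplace_class f \<and> (\<forall>\<theta>\<ge>0. (\<integral>\<omega>. exp (- (\<theta> \<bullet> Y \<omega>)) \<partial>M) = f \<theta> ^ n)"
  shows "infinitely_divisible M Y"
  unfolding infinitely_divisible_def
proof (intro allI impI)
  interpret M: prob_space M by fact
  fix n :: nat
  assume n: "1 \<le> n"
  obtain f where f: "laplace_class f"
    and fn: "\<And>\<theta>. 0 \<le> \<theta> \<Longrightarrow> (\<integral>\<omega>. exp (- (\<theta> \<bullet> Y \<omega>)) \<partial>M) = f \<theta> ^ n"
    using roots[OF n] by blast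
  obtain C \<mu> where \<mu>: "0 \<le> C" "prob_space \<mu>" "sets \<mu> = sets borel" "AE x in \<mu>. 0 \<le> x"
    "\<And>\<theta>. 0 \<le> \<theta> \<Longrightarrow> 0 \<le> f \<theta>"
    "\<And>\<theta>. 0 \<le> \<theta> \<Longrightarrow> ennreal (f \<theta>) = ennreal C * (\<integral>\<^sup>+x. ennreal (exp (- (\<theta> \<bullet> x))) \<partial>\<mu>)"
    using f unfolding laplace_class_def by blast
  note [measurable_cong] = \<mu>(3)
  interpret \<mu>: prob_space \<mu> by fact
  have "f 0 = C" using \<mu>(6)[of 0] \<mu>(1) \<mu>(5)[of 0] by (simp add: \<mu>.emeasure_space_1)
  moreover have "f 0 ^ n = 1" using fn[of 0] by (simp add: M.prob_space)
  ultimately have "C = 1"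
    using \<mu>(1) n power_eq_1_iff[of C n] by auto
  then have transform_\<mu>: "(\<integral>\<^sup>+x. ennreal (exp (- (\<theta> \<bullet> x))) \<partial>\<mu>) = ennreal (f \<theta>)" if "0 \<le> \<theta>" for \<theta>
    using \<mu>(6)[OF that] by simp
  let ?I = "{..<n}"
  let ?N = "PiM ?I (\<lambda>_. \<mu>)"
  interpret P: product_prob_space "\<lambda>_. \<mu>" ?I ..
  interpret F: finite_product_sigma_finite "\<lambda>_. \<mu>" ?I by standard simp
  have sets_N [measurable_cong]: "sets ?N = sets (PiM ?I (\<lambda>_. borel))"
    by (rule sets_PiM_cong) (simp_all add: \<mu>(3))
  have marginal: "distr ?N borel (\<lambda>\<omega>. \<omega> i) = \<mu>" if "i < n" for i
  proof -
    have "distr ?N borel (\<lambda>\<omega>. \<omega> i) = distr ?N \<mu> (\<lambda>\<omega>. \<omega> i)"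
      by (rule distr_cong) (simp_all add: \<mu>(3))
    also have "\<dots> = \<mu>" using that P.PiM_component[of i] by simp
    finally show ?thesis .
  qed
  have indep: "P.indep_vars (\<lambda>_. borel) (\<lambda>i \<omega>. \<omega> i) ?I"
  proof (subst P.indep_vars_iff_distr_eq_PiM')
    show "?I \<noteq> {}" using n by (auto simp: lessThan_empty_iff)
    show "(\<lambda>\<omega>. \<omega> i) \<in> borel_measurable ?N" if "i \<in> ?I" for i
      using that by measurable
    have "distr ?N (PiM ?I (\<lambda>_. borel)) (\<lambda>\<omega>. \<lambda>i\<in>?I. \<omega> i) = distr ?N ?N (\<lambda>\<omega>. \<omega>)"
      by (rule distr_cong) (auto simp: sets_N space_PiM PiE_restrict)
    also have "\<dots> = ?N" by simp
    also have "\<dots> = PiM ?I (\<lambda>i. distr ?N borel (\<lambda>\<omega>. \<omega> i))"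
      by (rule PiM_cong) (simp_all add: marginal)
    finally show "distr ?N (PiM ?I (\<lambda>_. borel)) (\<lambda>\<omega>. \<lambda>i\<in>?I. \<omega> i) = PiM ?I (\<lambda>i. distr ?N borel (\<lambda>\<omega>. \<omega> i))" .
  qed
  have sum_meas [measurable]: "(\<lambda>\<omega>. \<Sum>i<n. \<omega> i) \<in> borel_measurable ?N"
    by (intro borel_measurable_sum) measurable
  have "distr M borel Y = distr ?N borel (\<lambda>\<omega>. \<Sum>i<n. \<omega> i)"
  proof (rule laplace_transform_unique)
    show "prob_space (distr M borel Y)" "prob_space (distr ?N borel (\<lambda>\<omega>. \<Sum>i<n. \<omega> i))"
      by (auto intro!: M.prob_space_distr P.prob_space_distr)
    show "AE x in distr M borel Y. 0 \<le> x"
      by (subst AE_distr_iff) (auto simp: Y_nonneg)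
    have "AE \<omega> in ?N. \<forall>i\<in>?I. 0 \<le> \<omega> i"
      by (intro AE_finite_allI AE_PiM_component \<mu>) auto
    then have "AE \<omega> in ?N. 0 \<le> (\<Sum>i<n. \<omega> i)"
      by eventually_elim (auto intro!: sum_nonneg)
    then show "AE x in distr ?N borel (\<lambda>\<omega>. \<Sum>i<n. \<omega> i). 0 \<le> x"
      by (subst AE_distr_iff) auto
    fix \<theta> :: "real ^ 'n"
    assume \<theta>: "0 \<le> \<theta>"
    have "(\<integral>\<^sup>+\<omega>. ennreal (exp (- (\<theta> \<bullet> (\<Sum>i<n. \<omega> i)))) \<partial>?N)
        = (\<integral>\<^sup>+\<omega>. (\<Prod>i<n. ennreal (exp (- (\<theta> \<bullet> \<omega> i)))) \<partial>?N)"
      by (simp add: inner_sum_right sum_negf[symmetric] exp_sum prod_ennreal)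
    also have "\<dots> = (\<Prod>i<n. \<integral>\<^sup>+x. ennreal (exp (- (\<theta> \<bullet> x))) \<partial>\<mu>)"
      by (intro P.product_nn_integral_prod) auto
    also have "\<dots> = ennreal (f \<theta> ^ n)"
      using \<mu>(5)[OF \<theta>] by (simp add: transform_\<mu>[OF \<theta>] ennreal_power)
    finally have "(\<integral>\<omega>. exp (- (\<theta> \<bullet> (\<Sum>i<n. \<omega> i))) \<partial>?N) = f \<theta> ^ n"
      using \<mu>(5)[OF \<theta>] by (subst integral_eq_nn_integral) auto
    then show "(\<integral>x. exp (- (\<theta> \<bullet> x)) \<partial>distr M borel Y) = (\<integral>x. exp (- (\<theta> \<bullet> x)) \<partial>distr ?N borel (\<lambda>\<omega>. \<Sum>i<n. \<omega> i))"
      by (simp add: integral_distr fn[OF \<theta>])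
  qed simp_all
  then show "\<exists>(N :: (nat \<Rightarrow> real ^ 'n) measure) Y'. prob_space N \<and>
      prob_space.indep_vars N (\<lambda>_. borel) Y' {..<n} \<and>
      (\<forall>i<n. \<forall>j<n. distr N borel (Y' i) = distr N borel (Y' j)) \<and>
      distr M borel Y = distr N borel (\<lambda>\<omega>. \<Sum>i<n. Y' i \<omega>)"
    using P.prob_space_axioms indep marginal
    by (intro exI[of _ ?N] exI[of _ "\<lambda>i \<omega>. \<omega> i"]) auto
qed

lemma matrix_inv_both:
  fixes A :: "real ^ 'n ^ 'n"
  assumes "invertible A"
  shows "A ** matrix_inv A = mat 1" "matrix_inv A ** A = mat 1"
  using someI_ex[OF assms[unfolded invertible_def]] unfolding matrix_inv_def by blast+

lemma positive_definite_invertible: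
  assumes "positive_definite A"
  shows "invertible A"
  unfolding invertible_left_inverse matrix_left_invertible_ker
proof (intro allI impI)
  fix x
  assume "A *v x = 0"
  then show "x = 0"
    using assms by (cases "x = 0") (auto simp: positive_definite_def)
qed

lemma positive_definite_matrix_inv:
  assumes "positive_definite A"
  shows "positive_definite (matrix_inv A)"
proof -
  let ?Q = "matrix_inv A"
  note inv = matrix_inv_both[OF positive_definite_invertible[OF assms]]
  have sym: "transpose ?Q = ?Q"
    using symmetric_right_inverse[OF _ inv(1)] assms by (simp add: positive_definite_def)
  have "positive_definite (transpose ?Q ** A ** ?Q)"
  proof (rule positive_definite_congruence[OF assms])
    show "det ?Q \<noteq> 0"
      using inv by (metis invertible_def invertible_det_nz)
  qed
  then show ?thesis
    by (simp add: sym inv)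
qed

text \<open>The coordinates are grouped by \<open>b\<close>, and \<open>U\<close> rotates inside the groups only, so conjugation
  by \<open>U\<close> fixes every diagonal matrix that is constant on the groups. Hence the inverse covariance
  matrix may be replaced by its conjugate with nonpositive off-diagonal entries in the determinant
  that gives the transform of the sums of squares, and elimination shows that all its negative
  powers are Laplace transforms.\<close>

lemma infinitely_divisible_grouped_squares:
  fixes X :: "'a \<Rightarrow> real ^ 'm" and b :: "'m \<Rightarrow> 'n::finite" and U :: "real ^ 'm ^ 'm"
  assumes "prob_space M" "gaussian_vector M X" "mean_zero M X"
    and cov: "covariance_matrix M X = \<Sigma>" and pd: "positive_definite \<Sigma>"
    and U: "orthogonal_matrix U" "\<And>i j. b i \<noteq> b j \<Longrightarrow> U $ i $ j = 0"
    and nonpos: "nonpos_off_diagonal (transpose U ** matrix_inv \<Sigma> ** U)"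
  shows "infinitely_divisible M (\<lambda>\<omega>. \<chi> p. \<Sum>i | b i = p. (X \<omega> $ i)\<^sup>2)"
proof -
  define Q where "Q = matrix_inv \<Sigma>"
  define R where "R = transpose U ** Q ** U"
  have pdQ: "positive_definite Q" and Q\<Sigma>: "Q ** \<Sigma> = mat 1"
    using positive_definite_matrix_inv[OF pd] matrix_inv_both[OF positive_definite_invertible[OF pd]]
    by (simp_all add: Q_def)
  have detU: "det U \<noteq> 0" and UU: "transpose U ** U = mat 1"
    using U(1) det_orthogonal_matrix[OF U(1)] by (auto simp: orthogonal_matrix)
  have detU2: "det U * det U = 1"
    using det_orthogonal_matrix[OF U(1)] by auto
  have pdR: "positive_definite R"
    unfolding R_def by (rule positive_definite_congruence[OF pdQ detU])
  have congr: "det (add_diag Q (\<lambda>i. \<theta> $ b i)) = det (add_diag R (\<lambda>i. \<theta> $ b i))" for \<theta> :: "real ^ 'n"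
  proof -
    define D :: "real ^ 'm ^ 'm" where "D = (\<chi> i j. if i = j then \<theta> $ b i else 0)"
    have split: "add_diag A (\<lambda>i. \<theta> $ b i) = A + D" for A
      by (simp add: add_diag_def D_def vec_eq_iff)
    have "(D ** U) $ i $ j = (U ** D) $ i $ j" for i j
      using U(2)[of i j]
      by (cases "b i = b j")
         (simp_all add: D_def matrix_matrix_mult_def if_distrib[of "\<lambda>x. x * _"] if_distrib[of "\<lambda>x. _ * x"] cong: if_cong)
    then have "D ** U = U ** D" by (simp add: vec_eq_iff)
    then have "transpose U ** D ** U = D"
      by (metis UU matrix_mul_assoc matrix_mul_lid)
    moreover
    have plus_mult: "(A + B) ** C = A ** C + B ** C"
      for A B C :: "real ^ 'm ^ 'm"
      by (simp add: matrix_matrix_mult_def vec_eq_iff sum.distrib distrib_right)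
    ultimately have "R + D = transpose U ** (Q + D) ** U"
      by (simp add: R_def matrix_add_ldistrib plus_mult)
    then have "det (R + D) = det U * det U * det (Q + D)"
      by (simp add: det_mul mult_ac)
    then show ?thesis by (simp add: split detU2)
  qed
  have in_class: "laplace_class (\<lambda>\<theta>::real ^ 'n. det (add_diag R (\<lambda>i. \<theta> $ b i)) powr (- \<alpha>))" if "0 < \<alpha>" for \<alpha>
  proof (rule laplace_class_det_eliminate[where R=UNIV and b=b, OF _ that])
    show "positive_definite (add_diag R (\<lambda>i. \<theta> $ b i))" if "0 \<le> \<theta>" for \<theta> :: "real ^ 'n"
      using that by (intro positive_definite_add_diag pdR) (simp add: less_eq_vec_def)
    show "laplace_class (\<lambda>\<theta>::real ^ 'n. - add_diag R (\<lambda>i. \<theta> $ b i) $ i $ j)" if "i \<noteq> j" for i j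
      using that nonpos laplace_class_const[of "- R $ i $ j"]
      by (simp add: add_diag_def nonpos_off_diagonal_def R_def Q_def)
    show "\<exists>d g. laplace_class g \<and> (\<forall>\<theta>\<ge>0. add_diag R (\<lambda>i. \<theta> $ b i) $ i $ i = d + \<theta> $ b i - g \<theta>)" for i
      by (rule exI[of _ "R $ i $ i"], rule exI[of _ "\<lambda>_. 0"])
         (simp add: laplace_class_const add_diag_def)
  qed simp_all
  have detQ: "0 < det Q" by (rule positive_definite_det_pos[OF pdQ])
  show ?thesis
  proof (rule infinitely_divisible_of_laplace_roots[OF assms(1)])
    have X [measurable]: "X \<in> borel_measurable M"
      using assms(2) by (simp add: gaussian_vector_def)
    have comp [measurable]: "(\<lambda>\<omega>. X \<omega> $ i) \<in> borel_measurable M" for i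
      by (rule borel_measurable_vec_component[OF X])
    show "(\<lambda>\<omega>. \<chi> p. \<Sum>i | b i = p. (X \<omega> $ i)\<^sup>2) \<in> borel_measurable M"
      by (subst borel_measurable_euclidean_space) (auto simp: Basis_vec_def inner_axis)
    show "0 \<le> (\<chi> p. \<Sum>i | b i = p. (X \<omega> $ i)\<^sup>2)" for \<omega>
      by (simp add: less_eq_vec_def sum_nonneg)
    fix n :: nat
    assume n: "1 \<le> n"
    \<comment> \<open>the transform is a power with exponent \<open>- 1 / 2\<close>, so its \<open>n\<close>-th root has exponent \<open>- \<alpha>\<close>;
       the factor \<open>2\<close> in front of \<open>\<theta>\<close> undoes the \<open>1 / 2\<close> in the Gaussian weights\<close>
    define \<alpha> where "\<alpha> = 1 / (2 * real n)"
    have \<alpha>: "0 < \<alpha>" "\<alpha> * real n = 1 / 2" using n by (simp_all add: \<alpha>_def)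
    define f :: "real ^ 'n \<Rightarrow> real" where "f \<theta> = det Q powr \<alpha> * det (add_diag R (\<lambda>i. (2 *\<^sub>R \<theta>) $ b i)) powr (- \<alpha>)" for \<theta>
    have "laplace_class f"
      unfolding f_def
      by (intro laplace_class_mult laplace_class_const laplace_class_rescale[OF in_class[OF \<alpha>(1)]]) auto
    moreover have "(\<integral>\<omega>. exp (- (\<theta> \<bullet> (\<chi> p. \<Sum>i | b i = p. (X \<omega> $ i)\<^sup>2))) \<partial>M) = f \<theta> ^ n"
      if \<theta>: "0 \<le> \<theta>" for \<theta> :: "real ^ 'n"
    proof -
      have grouped: "\<theta> \<bullet> (\<chi> p. \<Sum>i | b i = p. (X \<omega> $ i)\<^sup>2) = (\<Sum>i\<in>UNIV. (2 *\<^sub>R \<theta>) $ b i * (X \<omega> $ i)\<^sup>2) / 2" for \<omega>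
      proof -
        have "\<theta> \<bullet> (\<chi> p. \<Sum>i | b i = p. (X \<omega> $ i)\<^sup>2) = (\<Sum>p\<in>UNIV. \<Sum>i\<in>{i \<in> UNIV. b i = p}. \<theta> $ b i * (X \<omega> $ i)\<^sup>2)"
          by (simp add: inner_vec_def sum_distrib_left)
        also have "\<dots> = (\<Sum>i\<in>UNIV. \<theta> $ b i * (X \<omega> $ i)\<^sup>2)"
          by (rule sum.group) auto
        finally show ?thesis by (simp add: sum_divide_distrib)
      qed
      have nonneg: "0 \<le> (2 *\<^sub>R \<theta>) $ b i" for i
        using \<theta> by (simp add: less_eq_vec_def)
      define d where "d = det (add_diag R (\<lambda>i. (2 *\<^sub>R \<theta>) $ b i))"
      have d: "0 < d"
        unfolding d_def by (intro positive_definite_det_pos positive_definite_add_diag pdR nonneg)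
      have "(\<integral>\<omega>. exp (- (\<theta> \<bullet> (\<chi> p. \<Sum>i | b i = p. (X \<omega> $ i)\<^sup>2))) \<partial>M) = (d / det Q) powr (- 1 / 2)"
        using gaussian_squares_transform[OF assms(1-5) pdQ Q\<Sigma> detQ, of "\<lambda>i. (2 *\<^sub>R \<theta>) $ b i", OF nonneg]
        unfolding grouped d_def congr[of "2 *\<^sub>R \<theta>", symmetric] by (simp only: minus_divide_left)
      also have "\<dots> = det Q powr (1 / 2) * d powr (- (1 / 2))"
        using d detQ by (simp add: powr_divide powr_minus_divide)
      also have "\<dots> = det Q powr (\<alpha> * real n) * d powr (- (\<alpha> * real n))"
        by (simp only: \<alpha>(2))
      also have "\<dots> = (det Q powr \<alpha> * d powr (- \<alpha>)) powr real n"
        by (simp add: powr_mult powr_powr)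
      also have "\<dots> = (det Q powr \<alpha> * d powr (- \<alpha>)) ^ n"
        using d detQ by (intro powr_realpow) simp
      finally show ?thesis by (simp only: f_def d_def)
    qed
    ultimately show "\<exists>f. laplace_class f \<and> (\<forall>\<theta>\<ge>0. (\<integral>\<omega>. exp (- (\<theta> \<bullet> (\<chi> p. \<Sum>i | b i = p. (X \<omega> $ i)\<^sup>2))) \<partial>M) = f \<theta> ^ n)"
      by blast
  qed
qed

section \<open>Signs of bilinear forms in the plane\<close>

definition mat2 :: "real \<Rightarrow> real \<Rightarrow> real \<Rightarrow> real \<Rightarrow> real ^ 2 ^ 2" where
  "mat2 a b c d = vector [vector [a, b], vector [c, d]]"

lemma mat2_nth [simp]:
  "mat2 a b c d $ 1 $ 1 = a" "mat2 a b c d $ 1 $ 2 = b" "mat2 a b c d $ 2 $ 1 = c" "mat2 a b c d $ 2 $ 2 = d"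
  by (simp_all add: mat2_def)

lemma orthogonal_mat2:
  assumes "a\<^sup>2 + c\<^sup>2 = 1" "b\<^sup>2 + d\<^sup>2 = 1" "a * b + c * d = 0"
  shows "orthogonal_matrix (mat2 a b c d)"
  using assms unfolding orthogonal_matrix
  by (simp add: vec_eq_iff forall_2 matrix_matrix_mult_def sum_2 transpose_def mat_def power2_eq_square mult.commute)

lemma transpose_mult_mult_nth_2:
  fixes A B C :: "real ^ 2 ^ 2"
  shows "(transpose A ** B ** C) $ i $ j
       = (A $ 1 $ i * B $ 1 $ 1 + A $ 2 $ i * B $ 2 $ 1) * C $ 1 $ j + (A $ 1 $ i * B $ 1 $ 2 + A $ 2 $ i * B $ 2 $ 2) * C $ 2 $ j"
  by (simp add: matrix_matrix_mult_def sum_2 transpose_def)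

text \<open>Here \<open>B\<close> is given by its singular vectors \<open>v\<close>, \<open>w\<close> and \<open>(- v2, v1)\<close>, \<open>(- w2, w1)\<close> with signed
  singular values \<open>p\<close> and \<open>r\<close>. In the frames of singular vectors the form is diagonal, and if
  \<open>v1 * v2 * w1 * w2 * r \<ge> 0\<close> the second vectors of these frames can be oriented such that all requirements
  hold. Otherwise the signs of the coordinates can be absorbed into the frames, so that \<open>v\<close>, \<open>w\<close> have positive
  coordinates and \<open>r < 0\<close>. Then the entries \<open>(1, 2)\<close> and \<open>(2, 1)\<close> are positive, and the sign hypothesis says
  that the entry \<open>(2, 2)\<close> is nonnegative. If \<open>v1 * w1 > v2 * w2\<close>, then also the entry \<open>(1, 1)\<close> is
  nonnegative, and the standard frames do. If \<open>v1 * w1 \<le> v2 * w2\<close>, the second frame is turned such that \<open>w\<close> gets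
  the coordinates \<open>(v2, v1)\<close>, the reflection of \<open>v\<close> in the diagonal: both diagonal entries become
  \<open>(p + r) * v1 * v2\<close>, and the other two become the positive numbers \<open>p * v1\<^sup>2 - r * v2\<^sup>2\<close> and
  \<open>p * v2\<^sup>2 - r * v1\<^sup>2\<close>. A final change of sign in the second frame makes the form nonpositive.\<close>

lemma singular_sign_pattern:
  fixes v1 v2 w1 w2 p r :: real and B :: "real ^ 2 ^ 2"
  assumes v: "v1\<^sup>2 + v2\<^sup>2 = 1" and w: "w1\<^sup>2 + w2\<^sup>2 = 1" and pr: "\<bar>r\<bar> \<le> p"
    and B: "B $ 1 $ 1 = p * v1 * w1 + r * v2 * w2" "B $ 1 $ 2 = p * v1 * w2 - r * v2 * w1"
      "B $ 2 $ 1 = p * v2 * w1 - r * v1 * w2" "B $ 2 $ 2 = p * v2 * w2 + r * v1 * w1"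
    and sign: "0 \<le> v2 * w2 * B $ 2 $ 2"
  shows "\<exists>U1 U2. orthogonal_matrix U1 \<and> orthogonal_matrix U2 \<and>
           0 \<le> U1 $ 2 $ 1 * U1 $ 2 $ 2 \<and> 0 \<le> U2 $ 2 $ 1 * U2 $ 2 $ 2 \<and>
           (\<forall>i j. (transpose U1 ** B ** U2) $ i $ j \<le> 0)"
proof (cases "0 \<le> v1 * v2 * w1 * w2 * r")
  case True
  \<comment> \<open>\<open>d1\<close> and \<open>d2\<close> orient the second vectors of the two frames\<close>
  have "\<exists>d1 d2 :: real. d1\<^sup>2 = 1 \<and> d2\<^sup>2 = 1 \<and> 0 \<le> d1 * a \<and> 0 \<le> d2 * b \<and> 0 \<le> d1 * d2 * r"
    if "0 \<le> a * b * r" for a b :: real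
  proof -
    define s :: "real \<Rightarrow> real" where "s x = (if 0 \<le> x then 1 else -1)" for x
    have s: "(s x)\<^sup>2 = 1" "0 \<le> s x * x" for x by (simp_all add: s_def)
    consider "a = 0" | "b = 0" | "a \<noteq> 0" "b \<noteq> 0" by blast
    then show ?thesis
    proof cases
      case 1
      then show ?thesis
        using s s(2)[of "s b * r"]
        by - (rule exI[of _ "s (s b * r)"], rule exI[of _ "s b"], simp add: mult.assoc)
    next
      case 2
      then show ?thesis
        using s s(2)[of "s a * r"]
        by - (rule exI[of _ "s a"], rule exI[of _ "s (s a * r)"], simp add: mult_ac)
    next
      case 3
      have "0 \<le> s a * s b * r"
        using 3 that by (auto simp: s_def zero_le_mult_iff mult_le_0_iff)
      then show ?thesis using s by blast
    qed
  qed
  from this[of "v1 * v2" "w1 * w2"] True obtain d1 d2 :: real where d: "d1\<^sup>2 = 1" "d2\<^sup>2 = 1" "0 \<le> d1 * (v1 * v2)" "0 \<le> d2 * (w1 * w2)" "0 \<le> d1 * d2 * r"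
    by (auto simp: mult.assoc)
  let ?U1 = "mat2 v1 (- d1 * v2) v2 (d1 * v1)" and ?U2 = "mat2 (- w1) (d2 * w2) (- w2) (- d2 * w1)"
  have Bv: "v1 * B $ 1 $ 1 + v2 * B $ 2 $ 1 = p * w1" "v1 * B $ 1 $ 2 + v2 * B $ 2 $ 2 = p * w2"
    "- v2 * B $ 1 $ 1 + v1 * B $ 2 $ 1 = - r * w2" "- v2 * B $ 1 $ 2 + v1 * B $ 2 $ 2 = r * w1"
    unfolding B using v by algebra+
  have o: "orthogonal_matrix ?U1" "orthogonal_matrix ?U2"
    using v w d(1,2) by (auto intro!: orthogonal_mat2 simp: power_mult_distrib add.commute)
  have "(transpose ?U1 ** B ** ?U2) $ 1 $ 1 = - p" 
    unfolding transpose_mult_mult_nth_2 mat2_nth Bv using w by algebra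
  moreover have "(transpose ?U1 ** B ** ?U2) $ 1 $ 2 = 0" 
    unfolding transpose_mult_mult_nth_2 mat2_nth Bv by (simp add: algebra_simps)
  moreover have "(transpose ?U1 ** B ** ?U2) $ 2 $ 1 = 0"
    unfolding transpose_mult_mult_nth_2 mat2_nth using Bv(3,4) by algebra
  moreover have "(transpose ?U1 ** B ** ?U2) $ 2 $ 2 = - (d1 * d2 * r)"
    unfolding transpose_mult_mult_nth_2 mat2_nth using Bv(3,4) w by algebra
  ultimately have "\<forall>i j. (transpose ?U1 ** B ** ?U2) $ i $ j \<le> 0"
    using pr d(5) by (auto simp: forall_2)
  moreover have "0 \<le> ?U1 $ 2 $ 1 * ?U1 $ 2 $ 2" "0 \<le> ?U2 $ 2 $ 1 * ?U2 $ 2 $ 2"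
    using d(3,4) by (simp_all add: mult_ac)
  ultimately show ?thesis using o by blast
next
  case False
  define s1 s2 t1 t2 where "s1 = sgn v1" and "s2 = sgn v2" and "t1 = sgn w1" and "t2 = sgn w2"
  define a1 a2 c1 c2 q where "a1 = \<bar>v1\<bar>" and "a2 = \<bar>v2\<bar>" and "c1 = \<bar>w1\<bar>" and "c2 = \<bar>w2\<bar>" and "q = \<bar>r\<bar>"
  have nz: "v1 \<noteq> 0" "v2 \<noteq> 0" "w1 \<noteq> 0" "w2 \<noteq> 0" "r \<noteq> 0"
  proof -
    have "v1 * v2 * w1 * w2 * r \<noteq> 0" using False by linarith
    then show "v1 \<noteq> 0" "v2 \<noteq> 0" "w1 \<noteq> 0" "w2 \<noteq> 0" "r \<noteq> 0" by auto
  qed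
  have sq: "s1\<^sup>2 = 1" "s2\<^sup>2 = 1" "t1\<^sup>2 = 1" "t2\<^sup>2 = 1"
    using nz by (simp_all add: s1_def s2_def t1_def t2_def sgn_if)
  have pos: "0 < a1" "0 < a2" "0 < c1" "0 < c2" "0 < q" "q \<le> p"
    using nz pr by (simp_all add: a1_def a2_def c1_def c2_def q_def)
  have eqs: "v1 = s1 * a1" "v2 = s2 * a2" "w1 = t1 * c1" "w2 = t2 * c2"
    by (simp_all add: s1_def s2_def t1_def t2_def a1_def a2_def c1_def c2_def sgn_mult_abs)
  have "sgn (v1 * v2 * w1 * w2 * r) = -1" using False by (intro sgn_neg) linarith
  then have "s1 * s2 * t1 * t2 * sgn r = -1" by (simp add: sgn_mult s1_def s2_def t1_def t2_def)
  then have "sgn r = - (s1 * s2 * t1 * t2)" using sq by algebra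
  then have r: "r = - (s1 * s2 * t1 * t2 * q)" 
    using sgn_mult_abs[of r] by (simp add: q_def)
  have unit: "a1\<^sup>2 + a2\<^sup>2 = 1" "c1\<^sup>2 + c2\<^sup>2 = 1"
    using v w by (simp_all add: a1_def a2_def c1_def c2_def)
  have B': "B $ 1 $ 1 = s1 * t1 * (p * a1 * c1 - q * a2 * c2)" "B $ 1 $ 2 = s1 * t2 * (p * a1 * c2 + q * a2 * c1)"
    "B $ 2 $ 1 = s2 * t1 * (p * a2 * c1 + q * a1 * c2)" "B $ 2 $ 2 = s2 * t2 * (p * a2 * c2 - q * a1 * c1)"
    unfolding B eqs r using sq by algebra+
  have "v2 * w2 * B $ 2 $ 2 = (a2 * c2) * (p * a2 * c2 - q * a1 * c1)"
    unfolding B' eqs using sq by algebra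
  then have dom: "0 \<le> p * a2 * c2 - q * a1 * c1"
    using sign pos by (metis mult_pos_pos zero_le_mult_iff not_less)
  let ?U1 = "mat2 s1 0 0 s2"
  have o1: "orthogonal_matrix ?U1" using sq by (intro orthogonal_mat2) auto
  show ?thesis
  proof (cases "a1 * c1 \<le> a2 * c2")
    case False
    let ?U2 = "mat2 (- t1) 0 0 (- t2)"
    have o2: "orthogonal_matrix ?U2" using sq by (intro orthogonal_mat2) auto
    have "q * (a2 * c2) \<le> p * (a1 * c1)"
      using False pos by (intro mult_mono[of q p "a2 * c2" "a1 * c1"]) auto
    then have ge: "0 \<le> p * a1 * c1 - q * a2 * c2" by (simp add: mult.assoc)
    have "(transpose ?U1 ** B ** ?U2) $ 1 $ 1 = - (p * a1 * c1 - q * a2 * c2)"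
      "(transpose ?U1 ** B ** ?U2) $ 1 $ 2 = - (p * a1 * c2 + q * a2 * c1)"
      "(transpose ?U1 ** B ** ?U2) $ 2 $ 1 = - (p * a2 * c1 + q * a1 * c2)"
      "(transpose ?U1 ** B ** ?U2) $ 2 $ 2 = - (p * a2 * c2 - q * a1 * c1)"
      unfolding transpose_mult_mult_nth_2 mat2_nth B' using sq by algebra+
    moreover have "0 \<le> p * a1 * c2 + q * a2 * c1" "0 \<le> p * a2 * c1 + q * a1 * c2"
      using pos by (intro add_nonneg_nonneg mult_nonneg_nonneg; simp)+
    ultimately have "\<forall>i j. (transpose ?U1 ** B ** ?U2) $ i $ j \<le> 0"
      using dom ge unfolding forall_2 by linarith
    then show ?thesis using o1 o2 by - (rule exI[of _ ?U1], rule exI[of _ ?U2], auto)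
  next
    case True
    \<comment> \<open>\<open>(x, y)\<close> is \<open>a2 * w - a1 * w'\<close> with \<open>w = (c1, c2)\<close> and \<open>w' = (- c2, c1)\<close>\<close>
    let ?x = "a2 * c1 + a1 * c2" and ?y = "a2 * c2 - a1 * c1"
    let ?U2 = "mat2 (- t1 * ?x) (t1 * ?y) (- t2 * ?y) (- t2 * ?x)"
    have "?x\<^sup>2 + ?y\<^sup>2 = 1" using unit by algebra
    then have o2: "orthogonal_matrix ?U2"
      using sq by (intro orthogonal_mat2; algebra)
    have "(transpose ?U1 ** B ** ?U2) $ 1 $ 1 = - ((p - q) * (a1 * a2))"
      "(transpose ?U1 ** B ** ?U2) $ 1 $ 2 = - (p * a1\<^sup>2 + q * a2\<^sup>2)"
      "(transpose ?U1 ** B ** ?U2) $ 2 $ 1 = - (p * a2\<^sup>2 + q * a1\<^sup>2)"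
      "(transpose ?U1 ** B ** ?U2) $ 2 $ 2 = - ((p - q) * (a1 * a2))"
      unfolding transpose_mult_mult_nth_2 mat2_nth B' using sq unit by algebra+
    moreover have "0 \<le> (p - q) * (a1 * a2)" "0 \<le> p * a1\<^sup>2 + q * a2\<^sup>2" "0 \<le> p * a2\<^sup>2 + q * a1\<^sup>2"
      using pos by simp_all
    ultimately have "\<forall>i j. (transpose ?U1 ** B ** ?U2) $ i $ j \<le> 0"
      unfolding forall_2 by linarith
    moreover have "0 \<le> ?U2 $ 2 $ 1 * ?U2 $ 2 $ 2"
    proof -
      have "?U2 $ 2 $ 1 * ?U2 $ 2 $ 2 = ?x * ?y"
        unfolding mat2_nth using sq by algebra
      also have "0 \<le> ?x * ?y" using pos True by simp
      finally show ?thesis .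
    qed
    ultimately show ?thesis using o1 o2 by - (rule exI[of _ ?U1], rule exI[of _ ?U2], auto)
  qed
qed


text \<open>In the plane one eigenvector of a symmetric matrix determines the other eigenvector
  \<open>(- v2, v1)\<close>, and the trace determines the other eigenvalue \<open>c'\<close>. The spectral decomposition is
  multiplied by \<open>N\<close>, the squared length of the eigenvector, so that no normalisation is needed.\<close>

lemma symmetric_2_spectral:
  fixes g11 g12 g22 c v1 v2 :: real
  assumes "g11 * v1 + g12 * v2 = c * v1" "g12 * v1 + g22 * v2 = c * v2"
  defines "c' \<equiv> g11 + g22 - c" and "N \<equiv> v1\<^sup>2 + v2\<^sup>2"
  shows "N * g11 = c * v1\<^sup>2 + c' * v2\<^sup>2" "N * g12 = (c - c') * (v1 * v2)" "N * g22 = c * v2\<^sup>2 + c' * v1\<^sup>2"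
    and "g11 * (- v2) + g12 * v1 = c' * (- v2)" "g12 * (- v2) + g22 * v1 = c' * v1"
  using assms(1,2) unfolding c'_def N_def by algebra+

lemma same_sign_decompose:
  fixes a b :: real
  assumes "0 \<le> a * b"
  obtains e where "e\<^sup>2 = 1" "0 \<le> e * a" "0 \<le> e * b"
proof (cases "0 \<le> a \<and> 0 \<le> b")
  case True
  then show ?thesis using that[of 1] by simp
next
  case False
  then have "a \<le> 0" "b \<le> 0" using assms by (auto simp: zero_le_mult_iff)
  then show ?thesis using that[of "-1"] by simp
qed

text \<open>A Perron-Frobenius argument. Let \<open>C\<close> be the nonpositive matrix of the form in the given frames.
  Then \<open>C ** transpose C\<close> has a nonnegative off-diagonal entry, so the coordinates \<open>m\<close>, \<open>n\<close> of its top
  eigenvector have a common sign \<open>e\<close>. By hypothesis so do the second coordinates of the vectors of either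
  frame; call these signs \<open>e1\<close> and \<open>e2\<close>. Expanding the three factors in the frames, the second
  coordinate of \<open>v\<close> has the sign \<open>e * e1\<close>, the entry \<open>B $ 2 $ 2\<close> the sign \<open>- e1 * e2\<close> and the second
  coordinate of \<open>transpose B *v v\<close> the sign \<open>- e * e2\<close>, and the product of these signs is \<open>1\<close>.\<close>

lemma sign_of_nonpositive_form:
  fixes B U1 U2 :: "real ^ 2 ^ 2" and v1 v2 c c' :: real
  assumes U1: "orthogonal_matrix U1" "0 \<le> U1 $ 2 $ 1 * U1 $ 2 $ 2"
    and U2: "orthogonal_matrix U2" "0 \<le> U2 $ 2 $ 1 * U2 $ 2 $ 2"
    and nonpos: "\<And>i j. (transpose U1 ** B ** U2) $ i $ j \<le> 0"
    and G: "G = B ** transpose B"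
    and ev: "G $ 1 $ 1 * v1 + G $ 1 $ 2 * v2 = c * v1" "G $ 1 $ 2 * v1 + G $ 2 $ 2 * v2 = c * v2"
    and nz: "v1 \<noteq> 0 \<or> v2 \<noteq> 0" and gap: "G $ 1 $ 1 + G $ 2 $ 2 - c < c"
  shows "0 \<le> v2 * B $ 2 $ 2 * (v2 * B $ 2 $ 2 + v1 * B $ 1 $ 2)"
proof -
  define C where "C = transpose U1 ** B ** U2"
  have UU1: "transpose U1 ** U1 = mat 1" "U1 ** transpose U1 = mat 1"
    and UU2: "transpose U2 ** U2 = mat 1" "U2 ** transpose U2 = mat 1"
    using U1(1) U2(1) by (simp_all add: orthogonal_matrix_def)
  have B_eq: "B = U1 ** C ** transpose U2"
    unfolding C_def using UU1 UU2 by (metis matrix_mul_assoc matrix_mul_lid matrix_mul_rid)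
  have CC: "C ** transpose C = transpose U1 ** G ** U1"
    unfolding C_def G matrix_transpose_mul transpose_transpose using UU2
    by (metis matrix_mul_assoc matrix_mul_lid matrix_mul_rid)
  define m where "m = v1 * U1 $ 1 $ 1 + v2 * U1 $ 2 $ 1"
  define n where "n = v1 * U1 $ 1 $ 2 + v2 * U1 $ 2 $ 2"
  have orth: "U1 $ 1 $ 1 * U1 $ 1 $ 2 + U1 $ 2 $ 1 * U1 $ 2 $ 2 = 0"
    using arg_cong[OF UU1(1), of "\<lambda>A. A $ 1 $ 2"]
    by (simp add: matrix_matrix_mult_def sum_2 transpose_def mat_def)
  have rows: "U1 $ 1 $ 1 * U1 $ 1 $ 1 + U1 $ 1 $ 2 * U1 $ 1 $ 2 = 1" "U1 $ 2 $ 1 * U1 $ 2 $ 1 + U1 $ 2 $ 2 * U1 $ 2 $ 2 = 1"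
    "U1 $ 1 $ 1 * U1 $ 2 $ 1 + U1 $ 1 $ 2 * U1 $ 2 $ 2 = 0"
    using arg_cong[OF UU1(2), of "\<lambda>A. A $ 1 $ 1"] arg_cong[OF UU1(2), of "\<lambda>A. A $ 2 $ 2"]
      arg_cong[OF UU1(2), of "\<lambda>A. A $ 1 $ 2"]
    by (simp_all add: matrix_matrix_mult_def sum_2 transpose_def mat_def)
  have v_eq: "v1 = U1 $ 1 $ 1 * m + U1 $ 1 $ 2 * n" "v2 = U1 $ 2 $ 1 * m + U1 $ 2 $ 2 * n"
    unfolding m_def n_def using rows by algebra+
  have G_sym: "G $ 2 $ 1 = G $ 1 $ 2"
    by (simp add: G matrix_matrix_mult_def sum_2 transpose_def mult.commute)
  define c' where "c' = G $ 1 $ 1 + G $ 2 $ 2 - c"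
  define N where "N = v1\<^sup>2 + v2\<^sup>2"
  note spec = symmetric_2_spectral[OF ev, folded c'_def N_def]
  have N: "0 < N" using nz by (auto simp: N_def sum_power2_gt_zero_iff)
  have CC12: "C $ 1 $ 1 * C $ 2 $ 1 + C $ 1 $ 2 * C $ 2 $ 2 = (C ** transpose C) $ 1 $ 2"
    by (simp add: matrix_matrix_mult_def sum_2 transpose_def)
  have "N * (C ** transpose C) $ 1 $ 2 = (c - c') * (m * n)"
  proof -
    have "N * (C ** transpose C) $ 1 $ 2
        = (U1 $ 1 $ 1 * (N * G $ 1 $ 1) + U1 $ 2 $ 1 * (N * G $ 1 $ 2)) * U1 $ 1 $ 2
        + (U1 $ 1 $ 1 * (N * G $ 1 $ 2) + U1 $ 2 $ 1 * (N * G $ 2 $ 2)) * U1 $ 2 $ 2"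
      unfolding CC transpose_mult_mult_nth_2 G_sym by (simp add: algebra_simps)
    also have "\<dots> = (c - c') * (m * n)"
      unfolding spec(1-3) m_def n_def using orth by algebra
    finally show ?thesis .
  qed
  moreover have "0 \<le> (C ** transpose C) $ 1 $ 2"
    unfolding CC12[symmetric] using nonpos by (auto simp: C_def intro!: add_nonneg_nonneg mult_nonpos_nonpos)
  ultimately have "0 \<le> (c - c') * (m * n)" using N by (metis mult_nonneg_nonneg less_imp_le)
  then have mn: "0 \<le> m * n" using gap by (simp add: c'_def zero_le_mult_iff)
  obtain e1 where e1: "e1\<^sup>2 = 1" "0 \<le> e1 * U1 $ 2 $ 1" "0 \<le> e1 * U1 $ 2 $ 2" using same_sign_decompose[OF U1(2)] .
  obtain e2 where e2: "e2\<^sup>2 = 1" "0 \<le> e2 * U2 $ 2 $ 1" "0 \<le> e2 * U2 $ 2 $ 2" using same_sign_decompose[OF U2(2)] .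
  obtain e where e: "e\<^sup>2 = 1" "0 \<le> e * m" "0 \<le> e * n" using same_sign_decompose[OF mn] .
  have C: "0 \<le> - C $ i $ j" for i j using nonpos[of i j] by (simp add: C_def)
  define V where "V = (e1 * U1 $ 2 $ 1) * (e * m) + (e1 * U1 $ 2 $ 2) * (e * n)"
  define W where "W = (e2 * U2 $ 2 $ 1) * (- C $ 1 $ 1 * (e * m) + - C $ 2 $ 1 * (e * n))
    + (e2 * U2 $ 2 $ 2) * (- C $ 1 $ 2 * (e * m) + - C $ 2 $ 2 * (e * n))"
  define Z where "Z = (e1 * U1 $ 2 $ 1) * (- C $ 1 $ 1 * (e2 * U2 $ 2 $ 1) + - C $ 1 $ 2 * (e2 * U2 $ 2 $ 2))
    + (e1 * U1 $ 2 $ 2) * (- C $ 2 $ 1 * (e2 * U2 $ 2 $ 1) + - C $ 2 $ 2 * (e2 * U2 $ 2 $ 2))"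
  have pos: "0 \<le> V" "0 \<le> W" "0 \<le> Z"
  proof -
    have gen: "0 \<le> x * (a * y + b * z) + x' * (a' * y + b' * z)"
      if "0 \<le> x" "0 \<le> x'" "0 \<le> y" "0 \<le> z" "0 \<le> a" "0 \<le> b" "0 \<le> a'" "0 \<le> b'" for x x' y z a b a' b' :: real
      using that by simp
    show "0 \<le> V" unfolding V_def by (intro add_nonneg_nonneg mult_nonneg_nonneg[OF e1(2) e(2)] mult_nonneg_nonneg[OF e1(3) e(3)])
    show "0 \<le> W" unfolding W_def by (rule gen[OF e2(2,3) e(2,3) C C C C])
    show "0 \<le> Z" unfolding Z_def by (rule gen[OF e1(2,3) e2(2,3) C C C C])
  qed
  have B_nth: "B $ i $ 2 = (U1 $ i $ 1 * C $ 1 $ 1 + U1 $ i $ 2 * C $ 2 $ 1) * U2 $ 2 $ 1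
      + (U1 $ i $ 1 * C $ 1 $ 2 + U1 $ i $ 2 * C $ 2 $ 2) * U2 $ 2 $ 2" for i
    by (subst B_eq) (simp add: matrix_matrix_mult_def sum_2 transpose_def)
  have f1: "v2 = e * e1 * V"
    unfolding v_eq(2) V_def using e(1) e1(1) by algebra
  have f2: "B $ 2 $ 2 = - (e1 * e2) * Z"
    unfolding B_nth Z_def using e1(1) e2(1) by algebra
  have f3: "v2 * B $ 2 $ 2 + v1 * B $ 1 $ 2 = - (e * e2) * W"
  proof -
    have "v2 * B $ 2 $ 2 + v1 * B $ 1 $ 2 = (m * C $ 1 $ 1 + n * C $ 2 $ 1) * U2 $ 2 $ 1 + (m * C $ 1 $ 2 + n * C $ 2 $ 2) * U2 $ 2 $ 2"
      unfolding B_nth m_def n_def by (simp add: algebra_simps)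
    also have "\<dots> = - (e * e2) * W"
      unfolding W_def using e(1) e2(1) by algebra
    finally show ?thesis .
  qed
  have "v2 * B $ 2 $ 2 * (v2 * B $ 2 $ 2 + v1 * B $ 1 $ 2) = (e\<^sup>2 * e1\<^sup>2 * e2\<^sup>2) * (V * Z * W)"
    unfolding f3 unfolding f1 f2 by (simp add: power2_eq_square)
  then show ?thesis using pos by (simp add: e(1) e1(1) e2(1))
qed

section \<open>Block orthogonal matrices\<close>

lemma block_diag_nth:
  "block_diag A B $ 1 $ 1 = A $ 1 $ 1" "block_diag A B $ 1 $ 2 = A $ 1 $ 2"
  "block_diag A B $ 1 $ 3 = 0" "block_diag A B $ 1 $ 4 = 0"
  "block_diag A B $ 2 $ 1 = A $ 2 $ 1" "block_diag A B $ 2 $ 2 = A $ 2 $ 2"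
  "block_diag A B $ 2 $ 3 = 0" "block_diag A B $ 2 $ 4 = 0"
  "block_diag A B $ 3 $ 1 = 0" "block_diag A B $ 3 $ 2 = 0"
  "block_diag A B $ 3 $ 3 = B $ 1 $ 1" "block_diag A B $ 3 $ 4 = B $ 1 $ 2"
  "block_diag A B $ 4 $ 1 = 0" "block_diag A B $ 4 $ 2 = 0"
  "block_diag A B $ 4 $ 3 = B $ 2 $ 1" "block_diag A B $ 4 $ 4 = B $ 2 $ 2"
  by (simp_all add: block_diag_def vector_4)

lemma block_diag_mult: "block_diag A B ** block_diag C D = block_diag (A ** C) (B ** D)"
  by (simp add: vec_eq_iff forall_4 matrix_matrix_mult_def sum_4 sum_2 block_diag_nth)

lemma transpose_block_diag: "transpose (block_diag A B) = block_diag (transpose A) (transpose B)"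
  by (simp add: vec_eq_iff forall_4 transpose_def block_diag_nth)

lemma block_diag_one: "block_diag (mat 1) (mat 1) = mat 1"
  by (simp add: vec_eq_iff forall_4 mat_def block_diag_nth)

lemma orthogonal_block_diag:
  assumes "orthogonal_matrix A" "orthogonal_matrix B"
  shows "orthogonal_matrix (block_diag A B)"
  using assms by (simp add: orthogonal_matrix transpose_block_diag block_diag_mult block_diag_one)

lemma congruence_entry:
  fixes V P :: "real ^ 4 ^ 4"
  shows "(transpose V ** P ** V) $ i $ j = (\<Sum>k\<in>UNIV. (\<Sum>l\<in>UNIV. V $ l $ i * P $ l $ k) * V $ k $ j)"
  by (simp add: matrix_matrix_mult_def transpose_def)

lemma upper_right_congruence:
  "upper_right (transpose (block_diag A B) ** P ** block_diag A B) = transpose A ** upper_right P ** B"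
  by (simp add: vec_eq_iff forall_2 upper_right_def matrix_matrix_mult_def transpose_def sum_4 sum_2
      block_diag_nth algebra_simps)

text \<open>The columns of \<open>V1\<close> are orthogonal, so the products of their first and of their second
  coordinates are opposite. This leaves a multiple of the gap between the two diagonal entries of \<open>S\<close> in
  the entry \<open>(1, 2)\<close>, and the condition on a diagonal block becomes one on the second coordinates.\<close>

lemma nonpos_off_diagonal_congruence:
  fixes S :: "real ^ 4 ^ 4"
  assumes S: "transpose S = S" "S $ 1 $ 2 = 0" "S $ 3 $ 4 = 0"
    and V: "orthogonal_matrix V1" "orthogonal_matrix V2"
  shows "nonpos_off_diagonal (transpose (block_diag V1 V2) ** S ** block_diag V1 V2) \<longleftrightarrow>
    0 \<le> (S $ 1 $ 1 - S $ 2 $ 2) * (V1 $ 2 $ 1 * V1 $ 2 $ 2) \<and>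
    0 \<le> (S $ 3 $ 3 - S $ 4 $ 4) * (V2 $ 2 $ 1 * V2 $ 2 $ 2) \<and>
    (\<forall>i j. (transpose V1 ** upper_right S ** V2) $ i $ j \<le> 0)"
proof -
  let ?T = "transpose (block_diag V1 V2) ** S ** block_diag V1 V2"
  have sym: "S $ i $ j = S $ j $ i" for i j
    using arg_cong[OF S(1), of "\<lambda>A. A $ j $ i"] by (simp add: transpose_def)
  have orth: "V $ 1 $ 1 * V $ 1 $ 2 = - (V $ 2 $ 1 * V $ 2 $ 2)" if "orthogonal_matrix V" for V :: "real ^ 2 ^ 2"
    using arg_cong[OF that[unfolded orthogonal_matrix], of "\<lambda>A. A $ 1 $ 2"]
    by (simp add: matrix_matrix_mult_def sum_2 transpose_def mat_def)
  have Tsym: "?T $ i $ j = ?T $ j $ i" for i j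
  proof -
    have "transpose ?T = ?T" by (simp add: matrix_transpose_mul S(1) matrix_mul_assoc)
    then have "transpose ?T $ j $ i = ?T $ j $ i" by (rule arg_cong)
    then show ?thesis unfolding transpose_def by (simp only: vec_lambda_beta)
  qed
  have T12: "?T $ 1 $ 2 = - ((S $ 1 $ 1 - S $ 2 $ 2) * (V1 $ 2 $ 1 * V1 $ 2 $ 2))"
  proof -
    have "?T $ 1 $ 2 = S $ 1 $ 1 * (V1 $ 1 $ 1 * V1 $ 1 $ 2) + S $ 2 $ 2 * (V1 $ 2 $ 1 * V1 $ 2 $ 2)"
      unfolding congruence_entry using S(2) sym[of 2 1] by (simp add: sum_4 block_diag_nth algebra_simps)
    then show ?thesis unfolding orth[OF V(1)] by (simp add: algebra_simps)
  qed
  have T34: "?T $ 3 $ 4 = - ((S $ 3 $ 3 - S $ 4 $ 4) * (V2 $ 2 $ 1 * V2 $ 2 $ 2))"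
  proof -
    have "?T $ 3 $ 4 = S $ 3 $ 3 * (V2 $ 1 $ 1 * V2 $ 1 $ 2) + S $ 4 $ 4 * (V2 $ 2 $ 1 * V2 $ 2 $ 2)"
      unfolding congruence_entry using S(3) sym[of 4 3] by (simp add: sum_4 block_diag_nth algebra_simps)
    then show ?thesis unfolding orth[OF V(2)] by (simp add: algebra_simps)
  qed
  have UR: "(transpose V1 ** upper_right S ** V2) $ i $ j = upper_right ?T $ i $ j" for i j
    by (simp only: upper_right_congruence)
  have "nonpos_off_diagonal T \<longleftrightarrow> T $ 1 $ 2 \<le> 0 \<and> T $ 3 $ 4 \<le> 0 \<and>
      T $ 1 $ 3 \<le> 0 \<and> T $ 1 $ 4 \<le> 0 \<and> T $ 2 $ 3 \<le> 0 \<and> T $ 2 $ 4 \<le> 0"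
    if "\<And>i j. T $ i $ j = T $ j $ i" for T :: "real ^ 4 ^ 4"
    unfolding nonpos_off_diagonal_def forall_4
    using that[of 2 1] that[of 3 1] that[of 4 1] that[of 3 2] that[of 4 2] that[of 4 3] by auto
  from this[of ?T, OF Tsym] show ?thesis
    unfolding T12 T34 UR by (simp add: forall_2 upper_right_def)
qed

section \<open>The equivalence and the theorem\<close>

text \<open>The singular value decomposition of \<open>B\<close> is computed from a top eigenvector of \<open>B ** transpose B\<close>: after
  normalisation, \<open>(x, y)\<close> and \<open>(w1, w2)\<close> are the singular vectors for \<open>p\<close>, and \<open>(z1, z2)\<close>, the image of the
  orthogonal direction \<open>(- y, x)\<close> under the transpose, is \<open>r\<close> times \<open>(- w2, w1)\<close>.\<close>

lemma nonpositive_frames_exist: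
  fixes B G :: "real ^ 2 ^ 2" and v1 v2 c :: real
  assumes G: "G = B ** transpose B"
    and ev: "G $ 1 $ 1 * v1 + G $ 1 $ 2 * v2 = c * v1" "G $ 1 $ 2 * v1 + G $ 2 $ 2 * v2 = c * v2"
    and nz: "v1 \<noteq> 0 \<or> v2 \<noteq> 0" and top: "G $ 1 $ 1 + G $ 2 $ 2 - c \<le> c"
    and sign: "0 \<le> v2 * B $ 2 $ 2 * (v2 * B $ 2 $ 2 + v1 * B $ 1 $ 2)"
  shows "\<exists>U1 U2. orthogonal_matrix U1 \<and> orthogonal_matrix U2 \<and>
           0 \<le> U1 $ 2 $ 1 * U1 $ 2 $ 2 \<and> 0 \<le> U2 $ 2 $ 1 * U2 $ 2 $ 2 \<and>
           (\<forall>i j. (transpose U1 ** B ** U2) $ i $ j \<le> 0)"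
proof (cases "B = 0")
  case True
  have "(mat 1 :: real ^ 2 ^ 2) $ 2 $ 1 = 0" by (simp add: mat_def)
  then show ?thesis
    by (intro exI[of _ "mat 1"]) (simp add: orthogonal_matrix_id True)
next
  case False
  define b11 b12 b21 b22 where "b11 = B $ 1 $ 1" and "b12 = B $ 1 $ 2" and "b21 = B $ 2 $ 1" and "b22 = B $ 2 $ 2"
  note b = b11_def b12_def b21_def b22_def
  have g: "G $ 1 $ 1 = b11\<^sup>2 + b12\<^sup>2" "G $ 1 $ 2 = b11 * b21 + b12 * b22" "G $ 2 $ 2 = b21\<^sup>2 + b22\<^sup>2"
    by (simp_all add: G b matrix_matrix_mult_def sum_2 transpose_def power2_eq_square)
  define n where "n = sqrt (v1\<^sup>2 + v2\<^sup>2)"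
  have n: "0 < n" "n\<^sup>2 = v1\<^sup>2 + v2\<^sup>2" using nz by (auto simp: n_def sum_power2_gt_zero_iff)
  define x y where "x = v1 / n" and "y = v2 / n"
  have v: "v1 = n * x" "v2 = n * y" using n by (simp_all add: x_def y_def)
  have xy: "x\<^sup>2 + y\<^sup>2 = 1"
  proof -
    have "n\<^sup>2 * (x\<^sup>2 + y\<^sup>2) = n\<^sup>2 * 1" using n(2) v by algebra
    then show ?thesis using n(1) by simp
  qed
  have ev1: "(b11\<^sup>2 + b12\<^sup>2) * x + (b11 * b21 + b12 * b22) * y = c * x"
    "(b11 * b21 + b12 * b22) * x + (b21\<^sup>2 + b22\<^sup>2) * y = c * y"
  proof -
    have "n * ((b11\<^sup>2 + b12\<^sup>2) * x + (b11 * b21 + b12 * b22) * y) = n * (c * x)"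
      "n * ((b11 * b21 + b12 * b22) * x + (b21\<^sup>2 + b22\<^sup>2) * y) = n * (c * y)"
      using ev unfolding g v by (simp_all add: algebra_simps)
    then show "(b11\<^sup>2 + b12\<^sup>2) * x + (b11 * b21 + b12 * b22) * y = c * x"
      "(b11 * b21 + b12 * b22) * x + (b21\<^sup>2 + b22\<^sup>2) * y = c * y"
      using n(1) by simp_all
  qed
  have "b11 \<noteq> 0 \<or> b12 \<noteq> 0 \<or> b21 \<noteq> 0 \<or> b22 \<noteq> 0"
    using False by (simp add: vec_eq_iff forall_2 b)
  then have "0 < b11\<^sup>2 + b12\<^sup>2 + b21\<^sup>2 + b22\<^sup>2"
    by (elim disjE) (simp_all add: add_nonneg_pos add_pos_nonneg)
  then have c: "0 < c" using top unfolding g by linarith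
  define p where "p = sqrt c"
  have p: "0 < p" "p\<^sup>2 = c" using c by (simp_all add: p_def)
  define w1 w2 where "w1 = (b11 * x + b21 * y) / p" and "w2 = (b12 * x + b22 * y) / p"
  have pw: "b11 * x + b21 * y = p * w1" "b12 * x + b22 * y = p * w2"
    using p by (simp_all add: w1_def w2_def)
  have w: "w1\<^sup>2 + w2\<^sup>2 = 1"
  proof -
    have "p\<^sup>2 * (w1\<^sup>2 + w2\<^sup>2) = (b11 * x + b21 * y)\<^sup>2 + (b12 * x + b22 * y)\<^sup>2"
      unfolding pw by algebra
    also have "\<dots> = p\<^sup>2 * 1"
      using ev1 xy p(2) by algebra
    finally show ?thesis using p(1) by simp
  qed
  define z1 z2 where "z1 = x * b21 - y * b11" and "z2 = x * b22 - y * b12"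
  define r where "r = z2 * w1 - z1 * w2"
  have "p * (z1 * w1 + z2 * w2) = z1 * (b11 * x + b21 * y) + z2 * (b12 * x + b22 * y)"
    unfolding pw by algebra
  also have "\<dots> = 0"
    unfolding z1_def z2_def using ev1 by algebra
  finally have zw: "z1 * w1 + z2 * w2 = 0" using p(1) by simp
  have z: "z1 = - r * w2" "z2 = r * w1"
    unfolding r_def using zw w by algebra+
  have "r\<^sup>2 = z1\<^sup>2 + z2\<^sup>2"
    unfolding z using w by algebra
  also have "\<dots> = b11\<^sup>2 + b12\<^sup>2 + (b21\<^sup>2 + b22\<^sup>2) - c"
    unfolding z1_def z2_def using ev1 xy by algebra
  also have "\<dots> \<le> p\<^sup>2" using top unfolding g p(2) .
  finally have r: "\<bar>r\<bar> \<le> p" using p(1) by (simp add: abs_le_square_iff[symmetric])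
  show ?thesis
  proof (rule singular_sign_pattern[OF xy w r])
    show "B $ 1 $ 1 = p * x * w1 + r * y * w2" "B $ 1 $ 2 = p * x * w2 - r * y * w1"
      "B $ 2 $ 1 = p * y * w1 - r * x * w2" "B $ 2 $ 2 = p * y * w2 + r * x * w1"
      unfolding b[symmetric] using pw z[unfolded z1_def z2_def] xy by algebra+
    have "v2 * B $ 2 $ 2 * (v2 * B $ 2 $ 2 + v1 * B $ 1 $ 2) = (n\<^sup>2 * p) * (y * w2 * B $ 2 $ 2)"
      unfolding b[symmetric] v using pw(2) by algebra
    then have "0 \<le> (n\<^sup>2 * p) * (y * w2 * B $ 2 $ 2)" using sign by (simp only:)
    moreover have "0 < n\<^sup>2 * p" using n(1) p(1) by simp
    ultimately show "0 \<le> y * w2 * B $ 2 $ 2" by (meson linorder_not_le mult_pos_neg)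
  qed
qed

text \<open>In the plane the direction orthogonal to \<open>v\<close> is an eigenvector for the trace minus \<open>c\<close>, so
  maximality of \<open>c\<close> compares these two numbers. They coincide only for multiples of the identity, where
  the convention \<open>v = (1, 0)\<close> makes the second coordinate vanish.\<close>

lemma top_eigenvector_properties:
  fixes A :: "real ^ 2 ^ 2"
  assumes top: "top_eigenvector A v" and sym: "A $ 2 $ 1 = A $ 1 $ 2"
  obtains c where "A $ 1 $ 1 * v $ 1 + A $ 1 $ 2 * v $ 2 = c * v $ 1" "A $ 1 $ 2 * v $ 1 + A $ 2 $ 2 * v $ 2 = c * v $ 2"
    "v $ 1 \<noteq> 0 \<or> v $ 2 \<noteq> 0" "A $ 1 $ 1 + A $ 2 $ 2 - c \<le> c"
    "A $ 1 $ 1 + A $ 2 $ 2 - c = c \<Longrightarrow> v $ 2 = 0"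
proof (cases "\<exists>c. A = mat c")
  case True
  then obtain c where A: "A = mat c" by blast
  have v: "v = vector [1, 0]" using top True by (simp add: top_eigenvector_def)
  show ?thesis by (rule that[of c]) (simp_all add: A v mat_def)
next
  case False
  then obtain c where c: "eigenpair A c v" and max: "\<And>d w. eigenpair A d w \<Longrightarrow> d \<le> c"
    using top by (auto simp: top_eigenvector_def)
  have ev: "A $ 1 $ 1 * v $ 1 + A $ 1 $ 2 * v $ 2 = c * v $ 1" "A $ 1 $ 2 * v $ 1 + A $ 2 $ 2 * v $ 2 = c * v $ 2"
    using c by (simp_all add: eigenpair_def vec_eq_iff forall_2 matrix_vector_mult_def sum_2 sym)
  have nz: "v $ 1 \<noteq> 0 \<or> v $ 2 \<noteq> 0"
    using c by (simp add: eigenpair_def vec_eq_iff forall_2)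
  note spec = symmetric_2_spectral[OF ev]
  \<comment> \<open>the orthogonal direction carries the other eigenvalue\<close>
  have "eigenpair A (A $ 1 $ 1 + A $ 2 $ 2 - c) (vector [- v $ 2, v $ 1])"
    using nz spec(4,5) by (auto simp: eigenpair_def vec_eq_iff forall_2 matrix_vector_mult_def sum_2 sym)
  then have le: "A $ 1 $ 1 + A $ 2 $ 2 - c \<le> c" by (rule max)
  have "A $ 1 $ 1 + A $ 2 $ 2 - c \<noteq> c"
  proof
    assume eq: "A $ 1 $ 1 + A $ 2 $ 2 - c = c"
    define N where "N = (v $ 1)\<^sup>2 + (v $ 2)\<^sup>2"
    have N: "0 < N" using nz by (auto simp: N_def sum_power2_gt_zero_iff)
    have "N * A $ 1 $ 1 = N * c" "N * A $ 1 $ 2 = N * 0" "N * A $ 2 $ 2 = N * c"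
      using spec(1-3) unfolding eq N_def by (simp_all add: algebra_simps)
    then have "A = mat c"
      using N by (simp add: vec_eq_iff forall_2 mat_def sym)
    then show False using False by blast
  qed
  then show ?thesis using that[OF ev nz le] by blast
qed

text \<open>The block orthogonal matrices form a group, so the search for a signature matrix may start
  from the diagonalised matrix.\<close>

lemma signature_condition_transfer:
  fixes P :: "real ^ 4 ^ 4"
  assumes W: "orthogonal_matrix W1" "orthogonal_matrix W2"
  shows "(\<exists>U. signature22 U \<and> nonpos_off_diagonal (transpose U ** P ** U)) \<longleftrightarrow>
    (\<exists>V1 V2. orthogonal_matrix V1 \<and> orthogonal_matrix V2 \<and>
      nonpos_off_diagonal (transpose (block_diag V1 V2) ** (transpose (block_diag W1 W2) ** P ** block_diag W1 W2) ** block_diag V1 V2))"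
proof -
  have comp: "transpose (block_diag V1 V2) ** (transpose (block_diag W1 W2) ** P ** block_diag W1 W2) ** block_diag V1 V2
      = transpose (block_diag (W1 ** V1) (W2 ** V2)) ** P ** block_diag (W1 ** V1) (W2 ** V2)" for V1 V2
    by (simp only: block_diag_mult[symmetric] matrix_transpose_mul matrix_mul_assoc)
  show ?thesis
    unfolding comp
  proof
    assume "\<exists>U. signature22 U \<and> nonpos_off_diagonal (transpose U ** P ** U)"
    then obtain U1 U2 where U: "orthogonal_matrix U1" "orthogonal_matrix U2"
      "nonpos_off_diagonal (transpose (block_diag U1 U2) ** P ** block_diag U1 U2)"
      unfolding signature22_def by blast
    have "W1 ** (transpose W1 ** U1) = U1" "W2 ** (transpose W2 ** U2) = U2"
      using W by (simp_all add: matrix_mul_assoc orthogonal_matrix_def)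
    moreover have "orthogonal_matrix (transpose W1 ** U1)" "orthogonal_matrix (transpose W2 ** U2)"
      using W U by (auto intro!: orthogonal_matrix_mul)
    ultimately show "\<exists>V1 V2. orthogonal_matrix V1 \<and> orthogonal_matrix V2 \<and>
        nonpos_off_diagonal (transpose (block_diag (W1 ** V1) (W2 ** V2)) ** P ** block_diag (W1 ** V1) (W2 ** V2))"
      using U(3) by metis
  next
    assume "\<exists>V1 V2. orthogonal_matrix V1 \<and> orthogonal_matrix V2 \<and>
        nonpos_off_diagonal (transpose (block_diag (W1 ** V1) (W2 ** V2)) ** P ** block_diag (W1 ** V1) (W2 ** V2))"
    then show "\<exists>U. signature22 U \<and> nonpos_off_diagonal (transpose U ** P ** U)"
      unfolding signature22_def using W orthogonal_matrix_mul by blast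
  qed
qed

text \<open>When a diagonal block of the conjugated matrix is a multiple of the identity, or when both singular
  values of the corner block coincide, the sign condition holds by the choice of \<open>W1\<close>, \<open>W2\<close> and \<open>v\<close>. In
  all other cases nonpositivity forces the columns of both frames to have second coordinates of equal
  sign, as the Perron-Frobenius argument requires.\<close>

lemma signature_iff_sign_condition:
  assumes pd: "positive_definite \<Sigma>" and adm: "admissible \<Sigma> W1 W2 v"
  shows "(\<exists>U. signature22 U \<and> nonpos_off_diagonal (transpose U ** matrix_inv \<Sigma> ** U))
           \<longleftrightarrow> sign_condition (conj_inverse \<Sigma> W1 W2) v"
proof -
  define P where "P = matrix_inv \<Sigma>"
  define S where "S = conj_inverse \<Sigma> W1 W2"
  define B where "B = upper_right S"
  define G where "G = B ** transpose B"
  have W: "orthogonal_matrix W1" "orthogonal_matrix W2"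
    and S0: "S $ 1 $ 2 = 0" "S $ 3 $ 4 = 0"
    and S_ge: "S $ 2 $ 2 \<le> S $ 1 $ 1" "S $ 4 $ 4 \<le> S $ 3 $ 3"
    and top: "top_eigenvector (transpose W1 ** upper_right P ** lower_left P ** W1) v"
    and fixed: "S $ 1 $ 1 = S $ 2 $ 2 \<or> S $ 3 $ 3 = S $ 4 $ 4 \<Longrightarrow> sign_condition S v"
    using adm by (auto simp: admissible_def Let_def S_def P_def)
  have S_eq: "S = transpose (block_diag W1 W2) ** P ** block_diag W1 W2"
    by (simp add: S_def P_def conj_inverse_def)
  have pdP: "positive_definite P" unfolding P_def by (rule positive_definite_matrix_inv[OF pd])
  then have symP: "transpose P = P" by (simp add: positive_definite_def)
  have symS: "transpose S = S" by (simp add: S_eq matrix_transpose_mul symP matrix_mul_assoc)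
  have "lower_left P = transpose (upper_right P)"
    using positive_definite_sym[OF pdP]
    by (simp add: vec_eq_iff forall_2 lower_left_def upper_right_def transpose_def)
  moreover have "W2 ** transpose W2 = mat 1" using W(2) by (simp add: orthogonal_matrix_def)
  moreover have B_eq: "B = transpose W1 ** upper_right P ** W2"
    by (simp add: B_def S_eq upper_right_congruence)
  ultimately have "transpose W1 ** upper_right P ** lower_left P ** W1 = G"
    unfolding G_def B_eq matrix_transpose_mul transpose_transpose
    by (metis matrix_mul_assoc matrix_mul_rid)
  with top have top: "top_eigenvector G v" by simp
  have symG: "G $ 2 $ 1 = G $ 1 $ 2"
    by (simp add: G_def matrix_matrix_mult_def sum_2 transpose_def mult.commute)
  obtain c where ev: "G $ 1 $ 1 * v $ 1 + G $ 1 $ 2 * v $ 2 = c * v $ 1" "G $ 1 $ 2 * v $ 1 + G $ 2 $ 2 * v $ 2 = c * v $ 2"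
    and nz: "v $ 1 \<noteq> 0 \<or> v $ 2 \<noteq> 0" and gap: "G $ 1 $ 1 + G $ 2 $ 2 - c \<le> c"
    and deg: "G $ 1 $ 1 + G $ 2 $ 2 - c = c \<Longrightarrow> v $ 2 = 0"
    using top_eigenvector_properties[OF top symG] by blast
  have sign: "sign_condition S v \<longleftrightarrow> 0 \<le> v $ 2 * B $ 2 $ 2 * (v $ 2 * B $ 2 $ 2 + v $ 1 * B $ 1 $ 2)"
    by (simp add: sign_condition_def B_def upper_right_def)
  have "(\<exists>U. signature22 U \<and> nonpos_off_diagonal (transpose U ** P ** U)) \<longleftrightarrow>
      (\<exists>V1 V2. orthogonal_matrix V1 \<and> orthogonal_matrix V2 \<and>
        nonpos_off_diagonal (transpose (block_diag V1 V2) ** S ** block_diag V1 V2))"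
    unfolding S_eq by (rule signature_condition_transfer[OF W])
  also have "\<dots> \<longleftrightarrow> sign_condition S v"
  proof
    assume "\<exists>V1 V2. orthogonal_matrix V1 \<and> orthogonal_matrix V2 \<and>
        nonpos_off_diagonal (transpose (block_diag V1 V2) ** S ** block_diag V1 V2)"
    then obtain V1 V2 where V: "orthogonal_matrix V1" "orthogonal_matrix V2"
      and "nonpos_off_diagonal (transpose (block_diag V1 V2) ** S ** block_diag V1 V2)"
      by blast
    then have d1: "0 \<le> (S $ 1 $ 1 - S $ 2 $ 2) * (V1 $ 2 $ 1 * V1 $ 2 $ 2)"
      and d2: "0 \<le> (S $ 3 $ 3 - S $ 4 $ 4) * (V2 $ 2 $ 1 * V2 $ 2 $ 2)"
      and off: "\<And>i j. (transpose V1 ** B ** V2) $ i $ j \<le> 0"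
      using nonpos_off_diagonal_congruence[OF symS S0 V] by (auto simp: B_def)
    show "sign_condition S v"
    proof (cases "S $ 1 $ 1 = S $ 2 $ 2 \<or> S $ 3 $ 3 = S $ 4 $ 4 \<or> G $ 1 $ 1 + G $ 2 $ 2 - c = c")
      case True
      then show ?thesis using fixed deg by (auto simp: sign)
    next
      case False
      then have "0 \<le> V1 $ 2 $ 1 * V1 $ 2 $ 2" "0 \<le> V2 $ 2 $ 1 * V2 $ 2 $ 2"
        using d1 d2 S_ge by (auto simp: zero_le_mult_iff)
      then show ?thesis
        unfolding sign using False gap
        by (intro sign_of_nonpositive_form[OF V(1) _ V(2) _ off G_def ev nz]) auto
    qed
  next
    assume "sign_condition S v"
    then obtain V1 V2 where V: "orthogonal_matrix V1" "orthogonal_matrix V2"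
      "0 \<le> V1 $ 2 $ 1 * V1 $ 2 $ 2" "0 \<le> V2 $ 2 $ 1 * V2 $ 2 $ 2"
      "\<forall>i j. (transpose V1 ** B ** V2) $ i $ j \<le> 0"
      using nonpositive_frames_exist[OF G_def ev nz gap] sign by blast
    have "nonpos_off_diagonal (transpose (block_diag V1 V2) ** S ** block_diag V1 V2)"
      unfolding nonpos_off_diagonal_congruence[OF symS S0 V(1,2)]
      using V(3-5) S_ge by (simp add: B_def)
    then show "\<exists>V1 V2. orthogonal_matrix V1 \<and> orthogonal_matrix V2 \<and>
        nonpos_off_diagonal (transpose (block_diag V1 V2) ** S ** block_diag V1 V2)"
      using V(1,2) by blast
  qed
  finally show ?thesis unfolding P_def S_def .
qed

theorem theorem2p6:
  fixes M :: "'a measure" and X :: "'a \<Rightarrow> real ^ 4" and \<Sigma> :: "real ^ 4 ^ 4"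
    and W1 W2 :: "real ^ 2 ^ 2" and v :: "real ^ 2"
  assumes "prob_space M"
    and "gaussian_vector M X" and "mean_zero M X"
    and "covariance_matrix M X = \<Sigma>" and "positive_definite \<Sigma>"
    and "admissible \<Sigma> W1 W2 v"
  shows "((\<exists>U. signature22 U \<and> nonpos_off_diagonal (transpose U ** matrix_inv \<Sigma> ** U))
           \<longleftrightarrow> sign_condition (conj_inverse \<Sigma> W1 W2) v)
       \<and> ((\<exists>U. signature22 U \<and> nonpos_off_diagonal (transpose U ** matrix_inv \<Sigma> ** U))
            \<and> sign_condition (conj_inverse \<Sigma> W1 W2) v
           \<longrightarrow> infinitely_divisible M
                 (\<lambda>\<omega>. vector [(X \<omega> $ 1)\<^sup>2 + (X \<omega> $ 2)\<^sup>2, (X \<omega> $ 3)\<^sup>2 + (X \<omega> $ 4)\<^sup>2] :: real ^ 2))"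
proof (intro conjI impI)
  show "(\<exists>U. signature22 U \<and> nonpos_off_diagonal (transpose U ** matrix_inv \<Sigma> ** U))
      \<longleftrightarrow> sign_condition (conj_inverse \<Sigma> W1 W2) v"
    by (rule signature_iff_sign_condition[OF assms(5,6)])
next
  assume "(\<exists>U. signature22 U \<and> nonpos_off_diagonal (transpose U ** matrix_inv \<Sigma> ** U))
      \<and> sign_condition (conj_inverse \<Sigma> W1 W2) v"
  then obtain U1 U2 where U: "orthogonal_matrix U1" "orthogonal_matrix U2"
    "nonpos_off_diagonal (transpose (block_diag U1 U2) ** matrix_inv \<Sigma> ** block_diag U1 U2)"
    unfolding signature22_def by blast
  define b :: "4 \<Rightarrow> 2" where "b i = (if i = 1 \<or> i = 2 then 1 else 2)" for i
  have b: "b 1 = 1" "b 2 = 1" "b 3 = 2" "b 4 = 2" by (simp_all add: b_def)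
  have "\<forall>i j. b i \<noteq> b j \<longrightarrow> block_diag U1 U2 $ i $ j = 0"
    unfolding forall_4 b block_diag_nth by simp
  then have "infinitely_divisible M (\<lambda>\<omega>. \<chi> p. \<Sum>i | b i = p. (X \<omega> $ i)\<^sup>2)"
    using U by (intro infinitely_divisible_grouped_squares[OF assms(1-5), of "block_diag U1 U2"] orthogonal_block_diag) auto
  moreover have "{i. b i = 1} = {1, 2}" "{i. b i = 2} = {3, 4}"
    using b by (auto simp: set_eq_iff forall_4)
  then have "(\<chi> p. \<Sum>i | b i = p. (X \<omega> $ i)\<^sup>2) = (vector [(X \<omega> $ 1)\<^sup>2 + (X \<omega> $ 2)\<^sup>2, (X \<omega> $ 3)\<^sup>2 + (X \<omega> $ 4)\<^sup>2] :: real ^ 2)" for \<omega>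
    by (simp add: vec_eq_iff forall_2)
  ultimately show "infinitely_divisible M
      (\<lambda>\<omega>. vector [(X \<omega> $ 1)\<^sup>2 + (X \<omega> $ 2)\<^sup>2, (X \<omega> $ 3)\<^sup>2 + (X \<omega> $ 4)\<^sup>2] :: real ^ 2)"
    by simp
qed

end
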